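(* Let $N\ge2$ be an integer, let $N<p<\infty$ and set $$\gamma_0:=\frac{\mathrm{cap}_p(\{0\};B_2)}{\mathrm{cap}_p(\overline{B_1};B_2)}=\frac{1}{2^{p-N}}\left(2^{\frac{p-N}{p-1}}-1\right)^{p-1}.$$ For every open set $\Omega\subseteq\mathbb{R}^N$ we have $$R_{p,\gamma}(\Omega)=r_\Omega\qquad\text{for every }0\le\gamma<\gamma_0.$$ Moreover, for every $R>0$, the punctured ball $\dot B_R:=B_R\setminus\{0\}$ satisfies $$R_{p,\gamma}(\dot B_R)>r_{\dot B_R}\qquad\text{for every }\gamma_0\le\gamma<1.$$
   Context: $B_r(x_0)=\{x\in\mathbb{R}^N: |x-x_0|<r\}$ and $B_r=B_r(0)$. The inradius of an open set $\Omega\subseteq\mathbb{R}^N$ is $r_\Omega=\sup\{r>0:\text{there exists a ball }B_r(x_0)\subseteq\Omega\}$. For an open set $E\subseteq\mathbb{R}^N$ and compact $\Sigma\subseteq E$, $$\mathrm{cap}_p(\Sigma;E)=\inf_{\varphi\in C^\infty_0(E)}\left\{\int_E|\nabla\varphi|^p\,dx : \varphi\ge1\text{ on }\Sigma\right\},$$ where $C^\infty_0(E)$ is the space of infinitely differentiable functions with compact support in $E$. For $0\le\gamma<1$, a compact set $\Sigma\subseteq\overline{B_r(x_0)}$ is $(p,\gamma)$-negligible if $\mathrm{cap}_p(\Sigma;B_{2r}(x_0))\le\gamma\,\mathrm{cap}_p(\overline{B_r(x_0)};B_{2r}(x_0))$. The capacitary inradius is $$R_{p,\gamma}(\Omega)=\sup\Big\{r>0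 : \exists x_0\in\mathbb{R}^N\text{ such that }\overline{B_r(x_0)}\setminus\Omega\text{ is }(p,\gamma)\text{-negligible}\Big\}.$$ The suprema may be $+\infty$; $\sup\emptyset=0$. *)

theory Defs
  imports "HOL-Analysis.Analysis"
begin

(* The type 'a plays the role of R^N, with N = DIM('a). *)

primrec C_k :: "nat \<Rightarrow> ('a::euclidean_space \<Rightarrow> real) \<Rightarrow> bool" where
  "C_k 0 f \<longleftrightarrow> continuous_on UNIV f"
| "C_k (Suc k) f \<longleftrightarrow> (\<forall>x. f differentiable (at x)) \<and>
     (\<forall>b\<in>Basis. C_k k (\<lambda>x. frechet_derivative f (at x) b))"

(* Elements of C_0^infinity(E) are represented by their extension by zero to the whole
   space. *)
definition test_functions :: "'a::euclidean_space set \<Rightarrow> ('a \<Rightarrow> real) set" where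
  "test_functions E =
     {\<phi>. (\<forall>k. C_k k \<phi>) \<and> compact (closure {x. \<phi> x \<noteq> 0}) \<and> closure {x. \<phi> x \<noteq> 0} \<subseteq> E}"

definition grad :: "('a::euclidean_space \<Rightarrow> real) \<Rightarrow> 'a \<Rightarrow> 'a" where
  "grad f x = (\<Sum>b\<in>Basis. frechet_derivative f (at x) b *\<^sub>R b)"

lemma gderiv_grad:
  assumes "f differentiable (at x)"
  shows "GDERIV f x :> grad f x"
proof -
  let ?f' = "frechet_derivative f (at x)"
  have der: "(f has_derivative ?f') (at x)"
    using assms by (simp add: frechet_derivative_works)
  then have lin: "linear ?f'"
    by (rule has_derivative_linear)
  have "?f' h = h \<bullet> grad f x" for h
  proof -
    have "?f' h = ?f' (\<Sum>b\<in>Basis. (h \<bullet> b) *\<^sub>R b)"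
      by (simp add: euclidean_representation)
    also have "\<dots> = (\<Sum>b\<in>Basis. (h \<bullet> b) * ?f' b)"
      by (simp add: linear_sum[OF lin] linear_scale[OF lin])
    also have "\<dots> = h \<bullet> grad f x"
      by (simp add: grad_def inner_sum_right mult.commute)
    finally show ?thesis .
  qed
  then have "?f' = (\<lambda>h. h \<bullet> grad f x)" by blast
  with der show ?thesis by (simp add: gderiv_def)
qed

(* The p-capacity of K relative to E, for K compact, E open and K \<subseteq> E. In that case the
   set of admissible functions is nonempty, the integrands are continuous with compact support
   and the integrals are nonnegative, so the infimum may be taken in the reals. *)
definition p_cap :: "real \<Rightarrow> 'a::euclidean_space set \<Rightarrow> 'a set \<Rightarrow> real" where
  "p_cap p K E =
     (INF \<phi>\<in>{\<phi> \<in> test_functions E. \<forall>x\<in>K. 1 \<le> \<phi> x}. LINT x:E|lborel. norm (grad \<phi> x) powr p)"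

definition pg_negligible :: "real \<Rightarrow> real \<Rightarrow> 'a::euclidean_space \<Rightarrow> real \<Rightarrow> 'a set \<Rightarrow> bool" where
  "pg_negligible p \<gamma> x0 r K \<longleftrightarrow> compact K \<and> K \<subseteq> cball x0 r \<and>
     p_cap p K (ball x0 (2 * r)) \<le> \<gamma> * p_cap p (cball x0 r) (ball x0 (2 * r))"

(* Both radii take values in [0,\<infinity>]; in ennreal the supremum of the empty set is 0. *)

definition inradius :: "'a::euclidean_space set \<Rightarrow> ennreal" where
  "inradius \<Omega> = (SUP r\<in>{r. 0 < r \<and> (\<exists>x0. ball x0 r \<subseteq> \<Omega>)}. ennreal r)"

definition cap_inradius :: "real \<Rightarrow> real \<Rightarrow> 'a::euclidean_space set \<Rightarrow> ennreal" where
  "cap_inradius p \<gamma> \<Omega> =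
     (SUP r\<in>{r. 0 < r \<and> (\<exists>x0. pg_negligible p \<gamma> x0 r (cball x0 r - \<Omega>))}. ennreal r)"

end

theory Submission
  imports Defs
begin

text \<open>Put \<open>\<beta> = (p - N) / (p - 1)\<close>. All capacities involved are controlled by
  \<open>c / (R powr \<beta> - s powr \<beta>) powr (p - 1)\<close>, the capacity of \<open>cball x0 s\<close> relative to
  \<open>ball x0 R\<close>, where \<open>s = 0\<close> gives the centre point because \<open>p > N\<close>. From below, the flux
  inequality \<open>N \<omega> \<le> \<integral> |\<nabla>\<phi>| |x - y| powr (1 - N)\<close> is combined with Young's inequality,
  where \<open>\<omega>\<close> is the volume of the unit ball; from above, smooth truncations of the radial potential are used.
  The flux inequality may be centred at any point \<open>y\<close> where \<open>\<phi>\<close> is at least 1, and among balls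
  of radius \<open>R\<close> the one around \<open>y\<close> maximises the resulting integral of a decreasing function of
  \<open>|x - y|\<close>. So every point of \<open>cball x0 r\<close> has at least \<open>\<gamma>0\<close> times the capacity of
  \<open>cball x0 r\<close> relative to \<open>ball x0 (2 * r)\<close>, with equality for the centre: below \<open>\<gamma>0\<close> a negligible
  set is empty, and from \<open>\<gamma>0\<close> on the centre of the punctured ball is negligible.\<close>

section \<open>Smooth functions and a cutoff\<close>

lemma C_k_const [simp]: "C_k k (\<lambda>x. c)"
  by (induction k arbitrary: c) auto

text \<open>By uniqueness of derivatives, any explicit formula \<open>f'\<close> may stand in for
  \<open>frechet_derivative\<close>, so smoothness can be read off from differentiation
  rules.\<close>

lemma C_k_SucI:
  assumes "\<And>x. (f has_derivative f' x) (at x)" "\<And>b. b \<in> Basis \<Longrightarrow> C_k k (\<lambda>x. f' x b)"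
  shows "C_k (Suc k) f"
proof -
  have "frechet_derivative f (at x) = f' x" for x
    using frechet_derivative_at[OF assms(1)] by simp
  then show ?thesis
    using assms by (auto intro: differentiableI)
qed

lemma C_k_SucI_real:
  fixes f :: "real \<Rightarrow> real"
  assumes "\<And>x. (f has_real_derivative f' x) (at x)" "C_k k f'"
  shows "C_k (Suc k) f"
  by (rule C_k_SucI[where f' = "\<lambda>x h. f' x * h"])
    (use assms in \<open>auto simp: has_field_derivative_def\<close>)

lemma C_k_SucD:
  assumes "C_k (Suc k) f"
  shows "(f has_derivative frechet_derivative f (at x)) (at x)"
    "b \<in> Basis \<Longrightarrow> C_k k (\<lambda>x. frechet_derivative f (at x) b)"
  using assms by (auto simp: frechet_derivative_works)

lemma C_k_imp_continuous_on: "C_k k f \<Longrightarrow> continuous_on UNIV f"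
  by (cases k)
    (auto simp: continuous_on_eq_continuous_at intro: differentiable_imp_continuous_within)

lemma C_k_Suc_imp: "C_k (Suc k) f \<Longrightarrow> C_k k f"
proof (induction k arbitrary: f)
  case 0
  then show ?case using C_k_imp_continuous_on[OF "0.prems"] by simp
next
  case (Suc k)
  then show ?case
    by (metis C_k.simps(2))
qed

lemma C_k_linear:
  assumes "bounded_linear f"
  shows "C_k k f"
proof (cases k)
  case 0
  then show ?thesis by (simp add: linear_continuous_on[OF assms])
next
  case (Suc m)
  then show ?thesis
    by (auto simp del: C_k.simps intro!: C_k_SucI[where f' = "\<lambda>x. f"] bounded_linear_imp_has_derivative assms)
qed

lemma C_k_add: "C_k k f \<Longrightarrow> C_k k g \<Longrightarrow> C_k k (\<lambda>x. f x + g x)"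
proof (induction k arbitrary: f g)
  case 0
  then show ?case by (simp add: continuous_on_add)
next
  case (Suc k)
  show ?case
    by (rule C_k_SucI[OF has_derivative_add[OF C_k_SucD(1)[OF Suc.prems(1)] C_k_SucD(1)[OF Suc.prems(2)]]])
      (rule Suc.IH[OF C_k_SucD(2)[OF Suc.prems(1)] C_k_SucD(2)[OF Suc.prems(2)]])
qed

lemma C_k_mult: "C_k k f \<Longrightarrow> C_k k g \<Longrightarrow> C_k k (\<lambda>x. f x * g x)"
proof (induction k arbitrary: f g)
  case 0
  then show ?case by (simp add: continuous_on_mult)
next
  case (Suc k)
  show ?case
    by (rule C_k_SucI[OF has_derivative_mult[OF C_k_SucD(1)[OF Suc.prems(1)] C_k_SucD(1)[OF Suc.prems(2)]]])
      (intro C_k_add Suc.IH C_k_SucD(2)[OF Suc.prems(1)] C_k_SucD(2)[OF Suc.prems(2)]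
        C_k_Suc_imp[OF Suc.prems(1)] C_k_Suc_imp[OF Suc.prems(2)])
qed

text \<open>The chain rule turns \<open>h\<close> into \<open>h'\<close>, of one order less, while
  \<open>q\<close> recurs unchanged in \<open>h' (q x)\<close>. Taking \<open>q\<close> smooth of
  all orders lets the induction run over \<open>h\<close> alone.\<close>

lemma C_k_compose_real:
  fixes h :: "real \<Rightarrow> real"
  shows "C_k k h \<Longrightarrow> (\<And>j. C_k j q) \<Longrightarrow> C_k k (\<lambda>x. h (q x))"
proof (induction k arbitrary: h)
  case 0
  then show ?case
    by (auto intro!: continuous_on_compose2[of UNIV h UNIV q] dest: C_k_imp_continuous_on[of _ q])
next
  case (Suc k)
  let ?h' = "\<lambda>t. frechet_derivative h (at t)"
  have q: "C_k (Suc k) q"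
    using Suc.prems by blast
  have lin: "linear (?h' t)" for t
    using C_k_SucD(1)[OF Suc.prems(1)] by (rule has_derivative_linear)
  have mult: "?h' t u = ?h' t 1 * u" for t u
    using linear_cmul[OF lin, of t u 1] by (simp add: mult.commute)
  show ?case
  proof (rule C_k_SucI)
    show "((\<lambda>x. h (q x)) has_derivative (\<lambda>b. ?h' (q x) 1 * frechet_derivative q (at x) b)) (at x)" for x
      using has_derivative_compose[OF C_k_SucD(1)[OF q] C_k_SucD(1)[OF Suc.prems(1)]]
      by (subst mult[symmetric])
    show "C_k k (\<lambda>x. ?h' (q x) 1 * frechet_derivative q (at x) b)" if "b \<in> Basis" for b
      by (intro C_k_mult Suc.IH C_k_SucD(2)[OF q that] C_k_SucD(2)[OF Suc.prems(1)] Suc.prems(2)) simp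
  qed
qed

lemma C_k_norm_square_diff: "C_k k (\<lambda>x. norm (x - a) ^ 2)"
proof (cases k)
  case 0
  then show ?thesis by (auto intro!: continuous_intros)
next
  case (Suc m)
  have "C_k (Suc m) (\<lambda>x. norm (x - a) ^ 2)"
  proof (rule C_k_SucI)
    show "((\<lambda>x. norm (x - a) ^ 2) has_derivative (\<lambda>h. 2 * (h \<bullet> (x - a)))) (at x)" for x
      unfolding power2_norm_eq_inner
      by (auto intro!: derivative_eq_intros simp: inner_commute algebra_simps)
    show "C_k m (\<lambda>x. 2 * (b \<bullet> (x - a)))" for b
    proof -
      have "C_k m (\<lambda>x. 2 * (b \<bullet> x) + - (2 * (b \<bullet> a)))"
        by (intro C_k_add C_k_mult C_k_const C_k_linear bounded_linear_inner_right)
      then show ?thesis by (simp add: inner_diff_right right_diff_distrib)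
    qed
  qed
  then show ?thesis using Suc by simp
qed

lemma linear_real_eq_mult:
  fixes g :: "real \<Rightarrow> real"
  assumes "linear g"
  shows "g = (*) (g 1)"
proof
  show "g x = g 1 * x" for x
    using linear_cmul[OF assms, of x 1] by (simp add: mult.commute)
qed

text \<open>Real powers are smooth away from 0, and the vanishing of \<open>f\<close> below
  \<open>a > 0\<close> hides the singularity. Differentiation lowers the exponent by one, so the
  induction needs all \<open>e\<close> at once.\<close>

lemma C_k_powr_mult:
  fixes f :: "real \<Rightarrow> real"
  assumes "C_k k f" "0 < a" "\<And>t. t < a \<Longrightarrow> f t = 0"
  shows "C_k k (\<lambda>t. t powr e * f t)"
  using assms
proof (induction k arbitrary: e f)
  case 0
  have "isCont (\<lambda>t. t powr e * f t) t" for t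
  proof (cases "t < a")
    case True
    then have "eventually (\<lambda>u. u < a) (nhds t)"
      by (simp add: eventually_nhds) (metis lessThan_iff open_lessThan)
    then have "eventually (\<lambda>u. u powr e * f u = 0) (nhds t)"
      by (rule eventually_mono) (use 0 in simp)
    from isCont_cong[OF this] show ?thesis by simp
  next
    case False
    have "isCont f t"
      using "0.prems"(1) by (simp add: continuous_on_eq_continuous_at)
    moreover have "isCont (\<lambda>t. t powr e) t"
      using False \<open>0 < a\<close> by (intro continuous_intros) auto
    ultimately show ?thesis
      by (rule isCont_mult[rotated])
  qed
  then show ?case
    by (simp add: continuous_on_eq_continuous_at)
next
  case (Suc k)
  let ?f' = "\<lambda>t. frechet_derivative f (at t) 1"
  have f': "(f has_real_derivative ?f' t) (at t)" for t
  proof -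
    have d: "(f has_derivative frechet_derivative f (at t)) (at t)"
      by (rule C_k_SucD(1)[OF Suc.prems(1)])
    then show ?thesis
      by (simp add: has_field_derivative_def linear_real_eq_mult[OF has_derivative_linear[OF d], symmetric])
  qed
  have zero: "(f has_real_derivative 0) (at t)" if "t < a" for t
  proof -
    have "eventually (\<lambda>u. u < a) (nhds t)"
      using that by (simp add: eventually_nhds) (metis lessThan_iff open_lessThan)
    then have "eventually (\<lambda>u. f u = 0) (nhds t)"
      by (rule eventually_mono) (use Suc.prems in simp)
    then show ?thesis
      using DERIV_cong_ev[OF refl _ refl, of f "\<lambda>_. 0" t 0] by simp
  qed
  have f'0: "?f' t = 0" if "t < a" for t
    using DERIV_unique[OF f' zero[OF that]] .
  show ?case
  proof (rule C_k_SucI_real)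
    show "((\<lambda>t. t powr e * f t) has_real_derivative
       e * (t powr (e - 1) * f t) + t powr e * ?f' t) (at t)" for t
    proof (cases "t < a")
      case True
      then have "eventually (\<lambda>u. u < a) (nhds t)"
        by (simp add: eventually_nhds) (metis lessThan_iff open_lessThan)
      then have "eventually (\<lambda>u. u powr e * f u = 0) (nhds t)"
        by (rule eventually_mono) (use Suc.prems in simp)
      from DERIV_cong_ev[OF refl this refl, of 0] show ?thesis
        using True Suc.prems(3) f'0 by simp
    next
      case False
      then have "0 < t" using Suc.prems by simp
      then show ?thesis
        by (auto intro!: derivative_eq_intros f')
    qed
    have "C_k k ?f'"
      using C_k_SucD(2)[OF Suc.prems(1), of 1] by simp
    then show "C_k k (\<lambda>t. e * (t powr (e - 1) * f t) + t powr e * ?f' t)"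
      using f'0 Suc.prems
      by (intro C_k_add C_k_mult C_k_const[of k e] Suc.IH[of f] Suc.IH[of ?f'] C_k_Suc_imp[of k f]) auto
  qed
qed

section \<open>The flat exponential cutoff\<close>

definition exp_cutoff :: "real \<Rightarrow> real" where
  "exp_cutoff t = (if 0 < t then exp (- 1 / t) else 0)"

text \<open>On the right of 0 the substitution \<open>u = 1 / t\<close> reduces this to the
  exponential outgrowing every polynomial; on the left the function is zero.\<close>

lemma poly_times_exp_cutoff_tendsto_0:
  "((\<lambda>t. poly P (1 / t) * exp_cutoff t) \<longlongrightarrow> 0) (at (0::real))"
proof -
  have "((\<lambda>u. \<Sum>i\<le>degree P. coeff P i * (u ^ i / exp u)) \<longlongrightarrow> (\<Sum>i\<le>degree P. coeff P i * 0)) at_top"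
    by (intro tendsto_intros tendsto_power_div_exp_0)
  then have "((\<lambda>u. poly P u * exp (- u)) \<longlongrightarrow> 0) at_top"
    by (simp add: poly_altdef sum_distrib_right exp_minus divide_inverse mult.assoc)
  then have "((\<lambda>t. poly P (inverse t) * exp (- inverse t)) \<longlongrightarrow> 0) (at_right (0::real))"
    by (rule filterlim_compose[OF _ filterlim_inverse_at_top_right])
  then have "((\<lambda>t. poly P (1 / t) * exp_cutoff t) \<longlongrightarrow> 0) (at_right (0::real))"
    by (rule Lim_transform_eventually)
      (simp add: exp_cutoff_def eventually_at_filter inverse_eq_divide)
  moreover have "((\<lambda>t. poly P (1 / t) * exp_cutoff t) \<longlongrightarrow> 0) (at_left (0::real))"
    by (rule tendsto_eventually) (simp add: exp_cutoff_def eventually_at_filter)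
  ultimately show ?thesis
    by (simp add: filterlim_at_split)
qed

text \<open>The functions \<open>P(1/t) * exp_cutoff t\<close> with \<open>P\<close> a polynomial
  are closed under differentiation: \<open>P\<close> becomes \<open>X^2 * (P - P')\<close>. The
  induction therefore treats the whole family, and \<open>P = 1\<close> is the claim.\<close>

lemma C_k_exp_cutoff: "C_k k exp_cutoff"
proof -
  have deriv: "((\<lambda>t. poly P (1 / t) * exp_cutoff t) has_real_derivative
    poly ([:0, 0, 1:] * (P - pderiv P)) (1 / t) * exp_cutoff t) (at t)" for P t
  proof (cases t "0 :: real" rule: linorder_cases)
    case equal
    \<comment> \<open>This is the difference quotient at 0: dividing by \<open>h\<close> multiplies
      the polynomial in \<open>1 / h\<close> by \<open>X\<close>.\<close>
    have "((\<lambda>h. poly ([:0, 1:] * P) (1 / h) * exp_cutoff h) \<longlongrightarrow> 0) (at 0)"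
      by (rule poly_times_exp_cutoff_tendsto_0)
    moreover have "exp_cutoff 0 = 0"
      by (simp add: exp_cutoff_def)
    ultimately show ?thesis
      by (simp add: equal DERIV_def)
  next
    case less
    then have "eventually (\<lambda>u. u < 0) (nhds t)"
      by (simp add: eventually_nhds) (metis lessThan_iff open_lessThan)
    then have "eventually (\<lambda>u. poly P (1 / u) * exp_cutoff u = 0) (nhds t)"
      by (rule eventually_mono) (simp add: exp_cutoff_def)
    from DERIV_cong_ev[OF refl this refl, of 0] show ?thesis
      using less by (simp add: exp_cutoff_def)
  next
    case greater
    then have "eventually (\<lambda>u. 0 < u) (nhds t)"
      by (simp add: eventually_nhds) (metis greaterThan_iff open_greaterThan)
    then have "eventually (\<lambda>u. poly P (1 / u) * exp_cutoff u = poly P (1 / u) * exp (- 1 / u)) (nhds t)"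
      by (rule eventually_mono) (simp add: exp_cutoff_def)
    note cutoff_eq = DERIV_cong_ev[OF refl this refl]
    have inv: "((\<lambda>u. 1 / u) has_real_derivative - (1 / t ^ 2)) (at t)"
      using greater by (auto intro!: derivative_eq_intros simp: power2_eq_square)
    have "((\<lambda>u. exp (- (1 / u))) has_real_derivative exp (- (1 / t)) * - (- (1 / t ^ 2))) (at t)"
      by (intro DERIV_fun_exp DERIV_minus inv)
    from DERIV_mult[OF DERIV_chain2[OF poly_DERIV[of P] inv] this]
    have "((\<lambda>u. poly P (1 / u) * exp (- (1 / u))) has_real_derivative
      poly ([:0, 0, 1:] * (P - pderiv P)) (1 / t) * exp (- (1 / t))) (at t)"
      by (rule DERIV_cong) (simp add: power2_eq_square algebra_simps)
    then show ?thesis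
      unfolding cutoff_eq using greater by (simp add: exp_cutoff_def)
  qed
  have "C_k k (\<lambda>t. poly P (1 / t) * exp_cutoff t)" for P
  proof (induction k arbitrary: P)
    case 0
    show ?case
      using DERIV_isCont[OF deriv] by (simp add: continuous_on_eq_continuous_at)
  next
    case (Suc k)
    show ?case
      by (rule C_k_SucI_real[OF deriv Suc.IH])
  qed
  from this[of "[:1:]"] show ?thesis by (simp only: poly_pCons poly_0 mult_zero_right add_0_right mult_1_left)
qed

section \<open>Integration of radial functions\<close>

text \<open>The image of Lebesgue measure under the norm is identified by its values on half-lines,
  which are volumes of balls. Differentiating the volume in the radius gives the density, without
  any surface measure.\<close>

lemma nn_integral_norm:
  fixes f :: "real \<Rightarrow> ennreal"
  assumes [measurable]: "f \<in> borel_measurable borel"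
  shows "(\<integral>\<^sup>+x. f (norm x) \<partial>(lborel :: 'a::euclidean_space measure)) =
    (\<integral>\<^sup>+r. ennreal (DIM('a) * unit_ball_vol DIM('a) * r ^ (DIM('a) - 1)) * indicator {0..} r * f r \<partial>lborel)"
proof -
  define w where "w = unit_ball_vol DIM('a)"
  have w: "0 \<le> w" by (simp add: w_def)
  let ?M = "distr (lborel :: 'a measure) borel norm"
  define g where "g = (\<lambda>r. ennreal (DIM('a) * w * r ^ (DIM('a) - 1)) * indicator {0..} r)"
  have [measurable]: "g \<in> borel_measurable borel" by (simp add: g_def)
  have M: "emeasure ?M {..a} = ennreal (if 0 \<le> a then w * a ^ DIM('a) else 0)" for a
  proof -
    have "emeasure ?M {..a} = emeasure lborel (cball (0 :: 'a) a)"
      by (subst emeasure_distr) (auto simp: cball_def intro!: arg_cong[of _ _ "emeasure _"])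
    then show ?thesis
      by (auto simp: emeasure_cball w_def)
  qed
  have "emeasure (density lborel g) {..a} = ennreal (if 0 \<le> a then w * a ^ DIM('a) else 0)" for a
  proof (cases "0 \<le> a")
    case True
    have "emeasure (density lborel g) {..a} =
      (\<integral>\<^sup>+r. ennreal (DIM('a) * w * r ^ (DIM('a) - 1)) * indicator {0..a} r \<partial>lborel)"
      by (subst emeasure_density) (auto simp: g_def intro!: nn_integral_cong split: split_indicator)
    also have "\<dots> = ennreal (w * a ^ DIM('a) - w * 0 ^ DIM('a))"
      using True w
      by (intro nn_integral_FTC_Icc) (auto intro!: derivative_eq_intros)
    finally show ?thesis
      using True by (simp add: power_0_left)
  next
    case False
    then have "(\<lambda>r. g r * indicator {..a} r) = (\<lambda>_. 0)"
      by (auto simp: g_def split: split_indicator)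
    then show ?thesis
      using False by (simp add: emeasure_density)
  qed
  \<comment> \<open>Half-lines form an intersection-stable generator, and those ending at natural
    numbers exhaust the line with finite measure.\<close>
  then have "?M = density lborel g"
    using M
    by (intro measure_eqI_generator_eq[where E = "range atMost" and \<Omega> = UNIV and A = "\<lambda>i. {..real i}"])
      (auto simp: Int_stable_def borel_eq_atMost[where 'a = real] intro: real_arch_simple)
  then have "(\<integral>\<^sup>+r. f r \<partial>?M) = (\<integral>\<^sup>+r. g r * f r \<partial>lborel)"
    by (simp add: nn_integral_density)
  then show ?thesis
    by (simp add: nn_integral_distr g_def w_def)
qed

text \<open>For \<open>a = 0\<close> and \<open>e < 1\<close> the integrand is unbounded near 0, so
  the fundamental theorem is used with differentiability only in the interior and continuity of the
  primitive up to the ends.\<close>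

lemma powr_has_integral_Icc:
  fixes a b e :: real
  assumes "0 < e" "0 \<le> a" "a \<le> b"
  shows "((\<lambda>r. r powr (e - 1)) has_integral (b powr e - a powr e) / e) {a..b}"
proof -
  have "((\<lambda>r. r powr (e - 1)) has_integral b powr e / e - a powr e / e) {a..b}"
  proof (rule fundamental_theorem_of_calculus_interior)
    show "continuous_on {a..b} (\<lambda>r. r powr e / e)"
      using assms by (intro continuous_intros continuous_on_powr') auto
    show "((\<lambda>r. r powr e / e) has_vector_derivative r powr (e - 1)) (at r)" if "r \<in> {a<..<b}" for r
      using that assms
      by (auto intro!: derivative_eq_intros simp: has_real_derivative_iff_has_vector_derivative[symmetric])
  qed (use assms in auto)
  then show ?thesis by (simp add: diff_divide_distrib)
qed

lemma nn_integral_powr_Icc: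
  fixes a b e :: real
  assumes "0 < e" "0 \<le> a" "a \<le> b"
  shows "(\<integral>\<^sup>+r. ennreal (r powr (e - 1)) * indicator {a..b} r \<partial>lborel) = ennreal ((b powr e - a powr e) / e)"
proof -
  have "(\<lambda>r. indicator {a..b} r * r powr (e - 1)) = (\<lambda>r. if r \<in> {a..b} then r powr (e - 1) else 0)"
    by (auto split: split_indicator)
  then have "((\<lambda>r. indicator {a..b} r * r powr (e - 1)) has_integral (b powr e - a powr e) / e) UNIV"
    using powr_has_integral_Icc[OF assms] by (simp only: has_integral_restrict_UNIV)
  from nn_integral_has_integral_lborel[OF _ _ this] show ?thesis
    by (simp add: ennreal_mult' ennreal_indicator mult.commute)
qed

text \<open>The radial density supplies the factor \<open>r ^ (DIM('a) - 1)\<close>, leaving a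
  one-dimensional integral of \<open>r powr (e - 1)\<close>. With \<open>e = \<beta>\<close> this
  is, up to a constant, the energy of the capacitary potential.\<close>

lemma nn_integral_norm_powr_annulus:
  fixes y :: "'a::euclidean_space" and e :: real
  assumes "0 < e" "0 \<le> s" "s \<le> R"
  shows "(\<integral>\<^sup>+x. ennreal (norm (x - y) powr (e - DIM('a))) * indicator {s..R} (norm (x - y)) \<partial>lborel) =
    ennreal (DIM('a) * unit_ball_vol DIM('a) * (R powr e - s powr e) / e)"
proof -
  let ?c = "DIM('a) * unit_ball_vol DIM('a)"
  let ?f = "\<lambda>r. ennreal (r powr (e - DIM('a))) * indicator {s..R} r"
  have "(\<integral>\<^sup>+x. ?f (norm (x - y)) \<partial>lborel) =
    (\<integral>\<^sup>+x. ?f (norm (x - y)) \<partial>distr lborel borel ((+) y))"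
    by (simp add: lborel_distr_plus)
  also have "\<dots> = (\<integral>\<^sup>+x. ?f (norm x) \<partial>(lborel :: 'a measure))"
    by (subst nn_integral_distr) auto
  also have "\<dots> = (\<integral>\<^sup>+r. ennreal (?c * r ^ (DIM('a) - 1)) * indicator {0..} r * ?f r \<partial>lborel)"
    by (rule nn_integral_norm) simp
  also have "\<dots> = (\<integral>\<^sup>+r. ennreal ?c * (ennreal (r powr (e - 1)) * indicator {s..R} r) \<partial>lborel)"
  proof (rule nn_integral_cong_AE, use AE_lborel_singleton[of 0] in eventually_elim)
    fix r :: real
    assume "r \<noteq> 0"
    have "r ^ (DIM('a) - 1) * r powr (e - DIM('a)) = r powr (e - 1)" if "0 < r"
      using that
      by (simp add: powr_realpow[symmetric] powr_add[symmetric] of_nat_diff Suc_le_eq)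
    with \<open>r \<noteq> 0\<close> \<open>0 \<le> s\<close>
    show "ennreal (?c * r ^ (DIM('a) - 1)) * indicator {0..} r * ?f r =
      ennreal ?c * (ennreal (r powr (e - 1)) * indicator {s..R} r)"
      by (auto simp: ennreal_mult'[symmetric] mult.assoc split: split_indicator)
  qed
  also have "\<dots> = ennreal ?c * ennreal ((R powr e - s powr e) / e)"
    by (subst nn_integral_cmult) (use assms in \<open>auto simp: nn_integral_powr_Icc\<close>)
  finally show ?thesis
    by (simp add: ennreal_mult'[symmetric])
qed

lemma nn_integral_lborel_scaleR:
  fixes h :: "'a::euclidean_space \<Rightarrow> ennreal"
  assumes [measurable]: "h \<in> borel_measurable borel" and "0 < t"
  shows "(\<integral>\<^sup>+x. h (t *\<^sub>R x) \<partial>lborel) = ennreal (1 / t ^ DIM('a)) * (\<integral>\<^sup>+z. h z \<partial>lborel)"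
proof -
  have "(\<integral>\<^sup>+z. h z \<partial>lborel) =
    (\<integral>\<^sup>+z. h z \<partial>density (distr lborel borel (\<lambda>x. 0 + t *\<^sub>R x)) (\<lambda>_. \<bar>t\<bar> ^ DIM('a)))"
    using \<open>0 < t\<close> by (subst lborel_affine[of t 0]) simp_all
  also have "\<dots> = ennreal (t ^ DIM('a)) * (\<integral>\<^sup>+x. h (t *\<^sub>R x) \<partial>lborel)"
    using \<open>0 < t\<close> by (simp add: nn_integral_density nn_integral_distr nn_integral_cmult)
  finally show ?thesis
    using \<open>0 < t\<close> by (simp add: mult.assoc[symmetric] ennreal_mult'[symmetric])
qed

lemma nn_integral_inverse_power:
  fixes a :: real
  assumes "0 < a" "0 < n"
  shows "(\<integral>\<^sup>+t. ennreal (1 / t ^ (n + 1)) * indicator {a<..} t \<partial>lborel) = ennreal (1 / (n * a ^ n))"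
proof -
  have "(\<integral>\<^sup>+t. ennreal (1 / t ^ (n + 1)) * indicator {a<..} t \<partial>lborel) =
    (\<integral>\<^sup>+t. ennreal (1 / t ^ (n + 1)) * indicator {a..} t \<partial>lborel)"
    by (rule nn_integral_cong_AE, use AE_lborel_singleton[of a] in eventually_elim)
      (auto split: split_indicator)
  also have "\<dots> = ennreal (0 - - (1 / (n * a ^ n)))"
  proof (rule nn_integral_FTC_atLeast)
    show "((\<lambda>t. - (1 / (n * t ^ n))) has_real_derivative 1 / t ^ (n + 1)) (at t)" if "a \<le> t" for t
    proof -
      obtain m where m: "n = Suc m" using \<open>0 < n\<close> gr0_implies_Suc by blast
      show ?thesis
        using that assms DERIV_cmult[OF DERIV_inverse_fun[OF DERIV_pow[of n t UNIV]], of "- (1 / n)"]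
        by (simp add: m field_simps del: of_nat_Suc)
    qed
    have "((\<lambda>t. 1 / real n * inverse (t ^ n)) \<longlongrightarrow> 1 / real n * 0) at_top"
      using \<open>0 < n\<close>
      by (intro tendsto_mult tendsto_const tendsto_inverse_0_at_top filterlim_pow_at_top filterlim_ident)
    then show "((\<lambda>t::real. - (1 / (n * t ^ n))) \<longlongrightarrow> 0) at_top"
      using tendsto_minus[of "\<lambda>t. 1 / (real n * t ^ n)" 0 at_top] by (simp add: field_simps)
  qed (use assms in auto)
  finally show ?thesis by simp
qed

text \<open>The common part of \<open>A\<close> and \<open>B\<close> cancels. The two differences
  have equal measure, and the level \<open>c\<close> separates the values of \<open>f\<close> on
  them.\<close>

lemma nn_integral_le_bathtub:
  assumes f [measurable]: "f \<in> borel_measurable M"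
    and [measurable]: "A \<in> sets M" "B \<in> sets M"
    and "emeasure M A = emeasure M B" "emeasure M B \<noteq> \<infinity>"
    and A: "\<And>x. x \<in> A - B \<Longrightarrow> f x \<le> c" and B: "\<And>x. x \<in> B - A \<Longrightarrow> c \<le> f x"
  shows "(\<integral>\<^sup>+x. f x * indicator A x \<partial>M) \<le> (\<integral>\<^sup>+x. f x * indicator B x \<partial>M)"
proof -
  have split: "(\<integral>\<^sup>+x. f x * indicator X x \<partial>M) =
    (\<integral>\<^sup>+x. f x * indicator (X \<inter> Y) x \<partial>M) + (\<integral>\<^sup>+x. f x * indicator (X - Y) x \<partial>M)"
    if [measurable]: "X \<in> sets M" "Y \<in> sets M" for X Y
    by (subst nn_integral_add[symmetric]) (auto intro!: nn_integral_cong split: split_indicator)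
  have "emeasure M (A - B) + emeasure M (A \<inter> B) = emeasure M (B - A) + emeasure M (A \<inter> B)"
    using assms(4) by (subst (1 2) plus_emeasure) (auto simp: Int_commute Un_commute Un_Diff_Int intro!: arg_cong[of _ _ "emeasure M"])
  moreover have "emeasure M (A \<inter> B) \<noteq> \<infinity>"
    using assms(5) emeasure_mono[of "A \<inter> B" B M] by (auto simp: top_unique)
  ultimately have eq: "emeasure M (A - B) = emeasure M (B - A)"
    by (simp add: add.commute[of _ "emeasure M (A \<inter> B)"] ennreal_add_left_cancel)
  have "(\<integral>\<^sup>+x. f x * indicator (A - B) x \<partial>M) \<le> (\<integral>\<^sup>+x. c * indicator (A - B) x \<partial>M)"
    by (intro nn_integral_mono) (auto intro!: A split: split_indicator)
  also have "\<dots> = (\<integral>\<^sup>+x. c * indicator (B - A) x \<partial>M)"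
    by (simp add: nn_integral_cmult_indicator eq)
  also have "\<dots> \<le> (\<integral>\<^sup>+x. f x * indicator (B - A) x \<partial>M)"
    by (intro nn_integral_mono) (auto intro!: B split: split_indicator)
  finally have "(\<integral>\<^sup>+x. f x * indicator (A - B) x \<partial>M) \<le> (\<integral>\<^sup>+x. f x * indicator (B - A) x \<partial>M)" .
  then show ?thesis
    by (simp add: split[of A B] split[of B A] Int_commute add_left_mono)
qed

section \<open>The flux inequality\<close>

lemma test_functions_imp_differentiable:
  assumes "\<phi> \<in> test_functions E"
  shows "\<phi> differentiable (at x)"
proof -
  have "C_k (Suc 0) \<phi>"
    using assms by (simp add: test_functions_def del: C_k.simps)
  then show ?thesis by simp
qed

lemma test_functions_has_derivative:
  "\<phi> \<in> test_functions E \<Longrightarrow> (\<phi> has_derivative (\<lambda>h. h \<bullet> grad \<phi> x)) (at x)"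
  using gderiv_grad[OF test_functions_imp_differentiable] by (simp add: gderiv_def)

lemma test_functions_continuous_grad:
  assumes "\<phi> \<in> test_functions E"
  shows "continuous_on UNIV (grad \<phi>)"
proof -
  have "C_k (Suc 0) \<phi>"
    using assms by (simp add: test_functions_def del: C_k.simps)
  then have "b \<in> Basis \<Longrightarrow> continuous_on UNIV (\<lambda>x. frechet_derivative \<phi> (at x) b)" for b
    by simp
  then have "continuous_on UNIV (\<lambda>x. \<Sum>b\<in>Basis. frechet_derivative \<phi> (at x) b *\<^sub>R b)"
    by (intro continuous_on_sum continuous_on_scaleR continuous_on_const) auto
  then show ?thesis
    by (simp add: grad_def[abs_def])
qed

lemma grad_eq_0_outside_support:
  assumes "x \<notin> closure {x. \<phi> x \<noteq> 0}"
  shows "grad \<phi> x = 0"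
proof -
  have "eventually (\<lambda>y. y \<in> - closure {x. \<phi> x \<noteq> 0}) (nhds x)"
    using assms by (intro eventually_nhds_in_open) auto
  then have "eventually (\<lambda>y. 0 = \<phi> y) (nhds x)"
    by (rule eventually_mono) (use closure_subset[of "{x. \<phi> x \<noteq> 0}"] in auto)
  moreover have "((\<lambda>_. 0) has_derivative (\<lambda>_. 0)) (at x)"
    by simp
  ultimately have "(\<phi> has_derivative (\<lambda>_. 0)) (at x)"
    using eventually_nhds_x_imp_x
    by (intro has_derivative_transform_eventually[of "\<lambda>_. 0" _ x UNIV \<phi>])
      (auto simp: eventually_nhds_conv_at)
  then have "frechet_derivative \<phi> (at x) = (\<lambda>_. 0)"
    by (rule frechet_derivative_at[symmetric])
  then show ?thesis
    by (simp add: grad_def)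
qed

lemma test_functions_outside:
  assumes "\<phi> \<in> test_functions E" "x \<notin> E"
  shows "\<phi> x = 0" "grad \<phi> x = 0"
proof -
  have "x \<notin> closure {x. \<phi> x \<noteq> 0}"
    using assms by (auto simp: test_functions_def)
  then show "grad \<phi> x = 0" "\<phi> x = 0"
    using subsetD[OF closure_subset, of x "{x. \<phi> x \<noteq> 0}"] by (blast intro: grad_eq_0_outside_support)+
qed

text \<open>The gradient is continuous and vanishes off a compact subset of \<open>E\<close>, so the
  energy is finite and the integral over \<open>E\<close> agrees with the one over the whole space.
  This passes from the real integrals of \<open>p_cap\<close> to nonnegative ones.\<close>

lemma ennreal_energy_eq:
  assumes "\<phi> \<in> test_functions E" "0 < p"
  shows "ennreal (LINT x:E|lborel. norm (grad \<phi> x) powr p) =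
    (\<integral>\<^sup>+x. ennreal (norm (grad \<phi> x) powr p) \<partial>lborel)"
proof -
  let ?g = "\<lambda>x. norm (grad \<phi> x) powr p"
  let ?K = "closure {x. \<phi> x \<noteq> 0}"
  have "continuous_on UNIV (\<lambda>x. norm (grad \<phi> x) powr p)"
    using test_functions_continuous_grad[OF assms(1)] \<open>0 < p\<close>
    by (intro continuous_on_powr' continuous_on_norm continuous_on_const) auto
  then have "continuous_on ?K ?g"
    by (rule continuous_on_subset) simp
  then have "integrable lborel (\<lambda>x. indicator ?K x *\<^sub>R ?g x)"
    using assms(1) by (intro borel_integrable_compact) (simp_all add: test_functions_def)
  moreover have "(\<lambda>x. indicator ?K x *\<^sub>R ?g x) = ?g"
    using grad_eq_0_outside_support[of _ \<phi>] by (auto split: split_indicator)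
  ultimately have int: "integrable lborel ?g"
    by simp
  have "(LINT x:E|lborel. ?g x) = (LINT x|lborel. ?g x)"
    unfolding set_lebesgue_integral_def
    using test_functions_outside[OF assms(1)]
    by (intro Bochner_Integration.integral_cong) (auto split: split_indicator)
  then show ?thesis
    using nn_integral_eq_integral[OF int] by simp
qed

text \<open>Along the ray from \<open>y\<close> in direction \<open>x\<close>, \<phi> drops from at
  least 1 on the sphere of radius \<open>s\<close> to 0 beyond \<open>E\<close>. The fundamental
  theorem and Cauchy-Schwarz bound this drop by the integral of the gradient norm.\<close>

lemma one_le_radial_integral_grad:
  assumes \<phi>: "\<phi> \<in> test_functions E" and "bounded E" and "x \<noteq> 0" and "0 \<le> s"
    and one: "\<And>z. dist z y = s \<Longrightarrow> 1 \<le> \<phi> z"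
  shows "1 \<le> (\<integral>\<^sup>+t. ennreal (norm (grad \<phi> (y + t *\<^sub>R x)) * norm x) *
    indicator {t. 0 < t \<and> s \<le> t * norm x} t \<partial>lborel)"
proof -
  \<comment> \<open>The parameter at which the ray meets the sphere of radius \<open>s\<close>
    around \<open>y\<close>.\<close>
  define a where "a = s / norm x"
  have "0 \<le> a" using \<open>0 \<le> s\<close> by (simp add: a_def)
  obtain B where B: "\<And>z. z \<in> E \<Longrightarrow> norm z < B"
    using bounded_normE_less[OF \<open>bounded E\<close>] by metis
  \<comment> \<open>Late enough for the ray to have left the ball of radius \<open>B\<close> around
    the origin, which contains \<open>E\<close>.\<close>
  define T where "T = a + (\<bar>B\<bar> + norm y) / norm x"
  have "a \<le> T" by (simp add: T_def)
  have "T * norm x = s + (\<bar>B\<bar> + norm y)"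
    using \<open>x \<noteq> 0\<close> by (simp add: T_def a_def field_simps)
  then have "T * norm x \<ge> \<bar>B\<bar> + norm y"
    using \<open>0 \<le> s\<close> by simp
  moreover have "norm (T *\<^sub>R x) \<le> norm (y + T *\<^sub>R x) + norm y"
    using norm_triangle_ineq4[of "y + T *\<^sub>R x" y] by simp
  moreover have "0 \<le> T" using \<open>0 \<le> a\<close> \<open>a \<le> T\<close> by simp
  ultimately have "B \<le> norm (y + T *\<^sub>R x)"
    by simp
  then have end0: "\<phi> (y + T *\<^sub>R x) = 0"
    using B test_functions_outside(1)[OF \<phi>] by fastforce
  have "dist (y + a *\<^sub>R x) y = s"
    using \<open>x \<noteq> 0\<close> \<open>0 \<le> s\<close> by (simp add: a_def dist_norm)
  then have start1: "1 \<le> \<phi> (y + a *\<^sub>R x)"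
    by (rule one)
  have cont: "continuous_on S (\<lambda>t. grad \<phi> (y + t *\<^sub>R x))" for S
    by (rule continuous_on_compose2[OF test_functions_continuous_grad[OF \<phi>]])
      (auto intro!: continuous_intros)
  let ?f = "\<lambda>t. norm (grad \<phi> (y + t *\<^sub>R x)) * norm x"
  have deriv: "((\<lambda>t. \<phi> (y + t *\<^sub>R x)) has_vector_derivative x \<bullet> grad \<phi> (y + t *\<^sub>R x)) (at t within S)" for t S
  proof -
    have "((\<lambda>t. y + t *\<^sub>R x) has_derivative (\<lambda>h. h *\<^sub>R x)) (at t)"
      by (auto intro!: derivative_eq_intros)
    from has_derivative_compose[OF this test_functions_has_derivative[OF \<phi>]]
    show ?thesis
      by (simp add: has_vector_derivative_def has_derivative_at_withinI)
  qed
  have "((\<lambda>t. x \<bullet> grad \<phi> (y + t *\<^sub>R x)) has_integral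
      \<phi> (y + T *\<^sub>R x) - \<phi> (y + a *\<^sub>R x)) {a..T}"
    using \<open>a \<le> T\<close> deriv by (rule fundamental_theorem_of_calculus)
  then have *: "((\<lambda>t. - (x \<bullet> grad \<phi> (y + t *\<^sub>R x))) has_integral \<phi> (y + a *\<^sub>R x)) {a..T}"
    using end0 by (auto dest: has_integral_neg)
  have int: "(?f has_integral integral {a..T} ?f) {a..T}"
    by (intro integrable_integral integrable_continuous_interval continuous_intros cont)
  have "\<phi> (y + a *\<^sub>R x) \<le> integral {a..T} ?f"
  proof (rule has_integral_le[OF * int])
    show "- (x \<bullet> grad \<phi> (y + t *\<^sub>R x)) \<le> ?f t" for t
      using Cauchy_Schwarz_ineq2[of x "grad \<phi> (y + t *\<^sub>R x)"] by (simp add: mult.commute)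
  qed
  then have "1 \<le> ennreal (integral {a..T} ?f)"
    using start1 by (simp add: ennreal_1[symmetric] del: ennreal_1)
  also have "\<dots> = (\<integral>\<^sup>+t. ennreal (if t \<in> {a..T} then ?f t else 0) \<partial>lborel)"
  proof (rule nn_integral_has_integral_lborel[symmetric])
    have [measurable]: "?f \<in> borel_measurable borel"
      by (intro borel_measurable_continuous_onI continuous_intros cont)
    show "(\<lambda>t. if t \<in> {a..T} then ?f t else 0) \<in> borel_measurable borel"
      by measurable
    show "((\<lambda>t. if t \<in> {a..T} then ?f t else 0) has_integral integral {a..T} ?f) UNIV"
      using int by (simp only: has_integral_restrict_UNIV)
  qed simp
  \<comment> \<open>For \<open>s = 0\<close> the interval starts at \<open>t = 0\<close>, which the
    indicator excludes; this single point is a null set.\<close>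
  also have "\<dots> \<le> (\<integral>\<^sup>+t. ennreal (?f t) * indicator {t. 0 < t \<and> s \<le> t * norm x} t \<partial>lborel)"
  proof (rule nn_integral_mono_AE, use AE_lborel_singleton[of 0] in eventually_elim)
    fix t :: real
    assume "t \<noteq> 0"
    have "0 < t \<and> s \<le> t * norm x" if "t \<in> {a..T}"
    proof -
      have "0 < t" "s / norm x \<le> t"
        using that \<open>0 \<le> a\<close> \<open>t \<noteq> 0\<close> by (auto simp: a_def)
      then show ?thesis
        using \<open>x \<noteq> 0\<close> by (simp add: pos_divide_le_eq)
    qed
    then show "ennreal (if t \<in> {a..T} then ?f t else 0)
      \<le> ennreal (?f t) * indicator {t. 0 < t \<and> s \<le> t * norm x} t"
      by (auto split: split_indicator)
  qed
  finally show ?thesis .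
qed

text \<open>The bound comes from averaging the radial estimate over the directions: with \<open>x\<close>
  uniform in the unit ball and \<open>z = t *\<^sub>R x\<close>, Tonelli's theorem replaces polar coordinates.\<close>

lemma nn_integral_grad_ge:
  fixes \<phi> :: "'a::euclidean_space \<Rightarrow> real"
  assumes \<phi>: "\<phi> \<in> test_functions E" and "bounded E" and "0 \<le> s"
    and one: "\<And>z. dist z y = s \<Longrightarrow> 1 \<le> \<phi> z"
  shows "ennreal (DIM('a) * unit_ball_vol DIM('a)) \<le>
    (\<integral>\<^sup>+x. ennreal (norm (grad \<phi> x) * norm (x - y) powr (1 - real DIM('a))) *
      indicator {x. s \<le> norm (x - y)} x \<partial>lborel)"
proof -
  let ?n = "DIM('a)"
  let ?g = "\<lambda>z. norm (grad \<phi> (y + z)) * norm z"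
  have cont: "continuous_on UNIV (\<lambda>z. grad \<phi> (y + z))"
    by (rule continuous_on_compose2[OF test_functions_continuous_grad[OF \<phi>]])
      (auto intro!: continuous_intros)
  have [measurable]: "(\<lambda>z. grad \<phi> (y + z)) \<in> borel_measurable borel" "grad \<phi> \<in> borel_measurable borel"
    using cont test_functions_continuous_grad[OF \<phi>]
    by (auto intro!: borel_measurable_continuous_onI)
  let ?F = "\<lambda>t x. ennreal (norm (grad \<phi> (y + t *\<^sub>R x)) * norm x) *
      indicator {t. 0 < t \<and> s \<le> t * norm x} t * indicator (ball 0 1) x"
  \<comment> \<open>Result of substituting \<open>z = t *\<^sub>R x\<close> in \<open>?F\<close>:
    the volume element gives \<open>1 / t ^ ?n\<close>, the factor
    \<open>norm x = norm z / t\<close> one more power, and \<open>norm x < 1\<close> becomes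
    \<open>norm z < t\<close>.\<close>
  let ?H = "\<lambda>t z. ennreal (?g z) * indicator {z. s \<le> norm z} z *
      (ennreal (1 / t ^ (?n + 1)) * indicator {norm z<..} t)"
  \<comment> \<open>Case distinctions in place of products of indicators make joint measurability in
    both variables visible for Tonelli.\<close>
  have F_eq: "?F t x = (if 0 < t \<and> s \<le> t * norm x \<and> norm x < 1
      then ennreal (norm (grad \<phi> (y + t *\<^sub>R x)) * norm x) else 0)" for t x
    by (auto split: split_indicator)
  have H_eq: "?H t z = (if s \<le> norm z \<and> norm z < t
      then ennreal (?g z) * ennreal (1 / t ^ (?n + 1)) else 0)" for t z
    by (auto split: split_indicator)
  have "ennreal (unit_ball_vol ?n) = (\<integral>\<^sup>+x. indicator (ball 0 1) x \<partial>(lborel :: 'a measure))"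
    by (simp add: emeasure_ball)
  also have "\<dots> \<le> (\<integral>\<^sup>+x. (\<integral>\<^sup>+t. ?F t x \<partial>lborel) \<partial>lborel)"
  proof (rule nn_integral_mono_AE, use AE_lborel_singleton[of 0] in eventually_elim)
    fix x :: 'a
    assume "x \<noteq> 0"
    have "1 \<le> (\<integral>\<^sup>+t. ennreal (norm (grad \<phi> (y + t *\<^sub>R x)) * norm x) *
      indicator {t. 0 < t \<and> s \<le> t * norm x} t \<partial>lborel)"
      by (rule one_le_radial_integral_grad[OF \<phi> \<open>bounded E\<close> \<open>x \<noteq> 0\<close> \<open>0 \<le> s\<close> one])
    then show "indicator (ball 0 1) x \<le> (\<integral>\<^sup>+t. ?F t x \<partial>lborel)"
      by (cases "x \<in> ball 0 1") auto
  qed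
  also have "\<dots> = (\<integral>\<^sup>+t. (\<integral>\<^sup>+x. ?F t x \<partial>lborel) \<partial>lborel)"
    by (rule lborel_pair.Fubini') (simp only: F_eq split_def, measurable)
  also have "\<dots> = (\<integral>\<^sup>+t. (\<integral>\<^sup>+z. ?H t z \<partial>lborel) \<partial>lborel)"
  proof (rule nn_integral_cong)
    fix t :: real
    show "(\<integral>\<^sup>+x. ?F t x \<partial>lborel) = (\<integral>\<^sup>+z. ?H t z \<partial>lborel)"
    proof (cases "0 < t")
      case True
      define h where "h = (\<lambda>z. if s \<le> norm z \<and> norm z < t then ennreal (?g z / t) else 0)"
      have [measurable]: "h \<in> borel_measurable borel"
        unfolding h_def by measurable
      have "(\<integral>\<^sup>+x. ?F t x \<partial>lborel) = (\<integral>\<^sup>+x. h (t *\<^sub>R x) \<partial>lborel)"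
        using True by (intro nn_integral_cong) (auto simp: h_def split: split_indicator)
      also have "\<dots> = ennreal (1 / t ^ ?n) * (\<integral>\<^sup>+z. h z \<partial>lborel)"
        using True by (intro nn_integral_lborel_scaleR) auto
      also have "\<dots> = (\<integral>\<^sup>+z. ennreal (1 / t ^ ?n) * h z \<partial>lborel)"
        by (rule nn_integral_cmult[symmetric]) measurable
      also have "\<dots> = (\<integral>\<^sup>+z. ?H t z \<partial>lborel)"
        using True
        by (intro nn_integral_cong)
          (auto simp: h_def ennreal_mult'[symmetric] field_simps split: split_indicator)
      finally show ?thesis .
    next
      case False
      then have "?F t x = 0" "?H t x = 0" for x
        using norm_ge_zero[of x] by (auto split: split_indicator simp del: norm_ge_zero)
      then show ?thesis by (simp only:)
    qed
  qed
  also have "\<dots> = (\<integral>\<^sup>+z. (\<integral>\<^sup>+t. ?H t z \<partial>lborel) \<partial>lborel)"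
    by (rule lborel_pair.Fubini') (simp only: H_eq split_def, measurable)
  \<comment> \<open>Integrating \<open>1 / t ^ (?n + 1)\<close> over \<open>t > norm z\<close> gives
    \<open>1 / (?n * norm z ^ ?n)\<close>, which combines with the factor \<open>norm z\<close> to
    the flux weight.\<close>
  also have "\<dots> = (\<integral>\<^sup>+z. ennreal (1 / ?n) * (ennreal (norm (grad \<phi> (y + z)) * norm z powr (1 - real ?n)) *
      indicator {z. s \<le> norm z} z) \<partial>lborel)"
  proof (rule nn_integral_cong_AE, use AE_lborel_singleton[of 0] in eventually_elim)
    fix z :: 'a
    assume "z \<noteq> 0"
    then have *: "norm z / norm z ^ ?n = norm z powr (1 - real ?n)"
      by (simp add: powr_diff powr_realpow)
    have "(\<integral>\<^sup>+t. ?H t z \<partial>lborel) = ennreal (?g z) * indicator {z. s \<le> norm z} z * ennreal (1 / (?n * norm z ^ ?n))"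
      using \<open>z \<noteq> 0\<close> by (subst nn_integral_cmult, measurable, subst nn_integral_inverse_power) auto
    also have "\<dots> = ennreal (1 / ?n) * (ennreal (norm (grad \<phi> (y + z)) * (norm z / norm z ^ ?n)) *
      indicator {z. s \<le> norm z} z)"
      by (auto simp: ennreal_mult'[symmetric] mult.commute split: split_indicator)
    finally show "(\<integral>\<^sup>+t. ?H t z \<partial>lborel) = ennreal (1 / ?n) *
      (ennreal (norm (grad \<phi> (y + z)) * norm z powr (1 - real ?n)) * indicator {z. s \<le> norm z} z)"
      unfolding * .
  qed
  also have "\<dots> = ennreal (1 / ?n) * (\<integral>\<^sup>+z. ennreal (norm (grad \<phi> (y + z)) * norm z powr (1 - real ?n)) *
      indicator {z. s \<le> norm z} z \<partial>lborel)"
    by (rule nn_integral_cmult) measurable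
  also have "(\<integral>\<^sup>+z. ennreal (norm (grad \<phi> (y + z)) * norm z powr (1 - real ?n)) *
      indicator {z. s \<le> norm z} z \<partial>lborel) =
    (\<integral>\<^sup>+x. ennreal (norm (grad \<phi> x) * norm (x - y) powr (1 - real ?n)) *
      indicator {x. s \<le> norm (x - y)} x \<partial>distr lborel borel ((+) y))"
    by (subst nn_integral_distr) (auto intro!: nn_integral_cong split: split_indicator)
  finally have "ennreal ?n * ennreal (unit_ball_vol ?n) \<le> ennreal ?n * (ennreal (1 / ?n) *
    (\<integral>\<^sup>+x. ennreal (norm (grad \<phi> x) * norm (x - y) powr (1 - real ?n)) *
      indicator {x. s \<le> norm (x - y)} x \<partial>lborel))"
    unfolding lborel_distr_plus by (rule mult_left_mono) simp
  then show ?thesis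
    by (simp add: mult.assoc[symmetric] ennreal_mult'[symmetric])
qed

section \<open>Energy estimates from below\<close>

text \<open>Tangent line inequality for the convex function \<open>a powr p\<close> at
  \<open>v\<close>, with equality at \<open>a = v\<close>; it is obtained here from Young's
  inequality with conjugate exponents \<open>p\<close> and \<open>p / (p - 1)\<close>.\<close>

lemma Young_powr:
  fixes a v p :: real
  assumes "1 < p" "0 \<le> a" "0 \<le> v"
  shows "p * v powr (p - 1) * a \<le> a powr p + (p - 1) * v powr p"
proof -
  define q where "q = p / (p - 1)"
  have "1 < q" "1 / p + 1 / q = 1"
    using assms by (simp_all add: q_def field_simps)
  from Youngs_inequality[OF \<open>1 < p\<close> this, of a "v powr (p - 1)"]
  have "a * v powr (p - 1) \<le> a powr p / p + v powr ((p - 1) * q) / q"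
    using assms by (simp add: powr_powr)
  also have "(p - 1) * q = p"
    using assms by (simp add: q_def)
  finally have "p * (a * v powr (p - 1)) \<le> p * (a powr p / p + v powr p / q)"
    using assms by (intro mult_left_mono) auto
  also have "p * (a powr p / p + v powr p / q) = a powr p + (p - 1) * v powr p"
    using assms by (simp add: q_def distrib_left)
  finally show ?thesis
    by (simp add: mult_ac)
qed

text \<open>The exponent \<beta> for which \<open>norm x powr \<beta>\<close> is p-harmonic off the
  origin of n-dimensional space.\<close>

definition cap_exp :: "real \<Rightarrow> real \<Rightarrow> real" where
  "cap_exp p n = (p - n) / (p - 1)"

text \<open>The flux of \<open>(\<beta> * r powr (\<beta> - 1)) powr (p - 1)\<close>, the gradient
  norm of the radial p-harmonic function to the power \<open>p - 1\<close>, through any sphere of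
  radius \<open>r\<close>.\<close>

definition cap_const :: "real \<Rightarrow> real \<Rightarrow> real" where
  "cap_const p n = n * unit_ball_vol n * cap_exp p n powr (p - 1)"

lemma cap_exp_pos: "n < p \<Longrightarrow> 1 < p \<Longrightarrow> 0 < cap_exp p n"
  by (simp add: cap_exp_def)

lemma cap_const_pos: "0 < n \<Longrightarrow> n < p \<Longrightarrow> 1 < p \<Longrightarrow> 0 < cap_const p n"
  using cap_exp_pos[of n p] by (simp add: cap_const_def)

text \<open>The gradient modulus \<open>d powr (\<beta> - 1)\<close> yields the flux weight
  \<open>d powr (1 - n)\<close> when raised to \<open>p - 1\<close>, and the energy density
  \<open>d powr (\<beta> - n)\<close> when raised to \<open>p\<close>.\<close>

lemma cap_exp_eqs:
  assumes "1 < p"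
  shows "(cap_exp p n - 1) * (p - 1) = 1 - n" "(cap_exp p n - 1) * p = cap_exp p n - n"
proof -
  have "cap_exp p n * (p - 1) = p - n"
    using assms by (simp add: cap_exp_def)
  then show *: "(cap_exp p n - 1) * (p - 1) = 1 - n"
    by (simp add: algebra_simps)
  show "(cap_exp p n - 1) * p = cap_exp p n - n"
    using * by (simp add: algebra_simps)
qed

lemma DIM_less_imp_gt_1:
  assumes "real DIM('a::euclidean_space) < p"
  shows "1 < p"
proof -
  have "1 \<le> real DIM('a)" by (simp add: Suc_leI)
  then show ?thesis using assms by linarith
qed

text \<open>The Young inequality is applied with \<open>v = c * d powr (\<beta> - 1)\<close>, the modulus of the gradient of
  the capacitary potential of the ball, so that equality holds for that potential.\<close>

lemma energy_ge:
  fixes \<phi> :: "'a::euclidean_space \<Rightarrow> real" and p \<beta> :: real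
  defines "\<beta> \<equiv> cap_exp p DIM('a)"
  assumes "real DIM('a) < p"
    and \<phi>: "\<phi> \<in> test_functions (ball x0 R)" and "0 \<le> s" "s < R"
    and one: "\<And>z. dist z y = s \<Longrightarrow> 1 \<le> \<phi> z"
    and le: "(\<integral>\<^sup>+x. ennreal (norm (x - y) powr (\<beta> - DIM('a))) *
      indicator (ball x0 R \<inter> {x. s \<le> norm (x - y)}) x \<partial>lborel)
      \<le> ennreal (DIM('a) * unit_ball_vol DIM('a) *
        (R powr \<beta> - s powr \<beta>) /
        \<beta>)"
  shows "cap_const p DIM('a) /
      (R powr \<beta> - s powr \<beta>) powr (p - 1)
    \<le> (LINT x:ball x0 R|lborel. norm (grad \<phi> x) powr p)"
proof -
  have p_gt_1: "1 < p"
    using \<open>real DIM('a) < p\<close> by (rule DIM_less_imp_gt_1)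
  have \<beta>_pos: "0 < \<beta>"
    using \<open>real DIM('a) < p\<close> p_gt_1 by (simp add: \<beta>_def cap_exp_pos)
  have exponent_eqs: "(\<beta> - 1) * (p - 1) = 1 - real DIM('a)" "(\<beta> - 1) * p = \<beta> - DIM('a)"
    using cap_exp_eqs[OF p_gt_1] by (simp_all add: \<beta>_def)
  define W where "W = DIM('a) * unit_ball_vol DIM('a)"
  have "0 \<le> W" by (simp add: W_def)
  define D where "D = R powr \<beta> - s powr \<beta>"
  have "0 < D"
    using \<open>0 \<le> s\<close> \<open>s < R\<close> \<beta>_pos by (simp add: D_def powr_less_mono2)
  \<comment> \<open>Normalises the potential \<open>(R powr \<beta> - d powr \<beta>) / D\<close>,
    which falls from 1 at distance \<open>s\<close> to 0 at distance \<open>R\<close>; its slope has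
    modulus \<open>c * d powr (\<beta> - 1)\<close>.\<close>
  define c where "c = \<beta> / D"
  have "0 < c" using \<beta>_pos \<open>0 < D\<close> by (simp add: c_def)
  let ?G = "\<lambda>x. norm (grad \<phi> x)"
  let ?d = "\<lambda>x. norm (x - y)"
  let ?S = "ball x0 R \<inter> {x. s \<le> ?d x}"
  define I where "I = (LINT x:ball x0 R|lborel. ?G x powr p)"
  have "0 \<le> I"
    by (simp add: I_def set_lebesgue_integral_def)
  have [measurable]: "grad \<phi> \<in> borel_measurable borel"
    using test_functions_continuous_grad[OF \<phi>] by (rule borel_measurable_continuous_onI)
  have [measurable]: "?S \<in> sets borel"
    by measurable
  have Young: "p * c powr (p - 1) * (?G x * ?d x powr (1 - real DIM('a)))
    \<le> ?G x powr p + (p - 1) * c powr p * ?d x powr (\<beta> - DIM('a))" for x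
  proof -
    have "(c * ?d x powr (\<beta> - 1)) powr (p - 1) = c powr (p - 1) * ?d x powr (1 - real DIM('a))"
      "(c * ?d x powr (\<beta> - 1)) powr p = c powr p * ?d x powr (\<beta> - DIM('a))"
      using \<open>0 < c\<close> by (simp_all only: powr_mult powr_powr exponent_eqs)
    then show ?thesis
      using Young_powr[of p "?G x" "c * ?d x powr (\<beta> - 1)"] p_gt_1 \<open>0 < c\<close>
      by (simp add: mult_ac)
  qed
  have "ennreal (p * c powr (p - 1) * W) = ennreal (p * c powr (p - 1)) * ennreal W"
    using p_gt_1 by (simp add: ennreal_mult')
  also have "\<dots> \<le> ennreal (p * c powr (p - 1)) *
    (\<integral>\<^sup>+x. ennreal (?G x * ?d x powr (1 - real DIM('a))) * indicator {x. s \<le> ?d x} x \<partial>lborel)"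
    unfolding W_def by (intro mult_left_mono nn_integral_grad_ge[OF \<phi> _ \<open>0 \<le> s\<close> one]) auto
  also have "\<dots> = (\<integral>\<^sup>+x. ennreal (p * c powr (p - 1)) *
    (ennreal (?G x * ?d x powr (1 - real DIM('a))) * indicator {x. s \<le> ?d x} x) \<partial>lborel)"
    by (rule nn_integral_cmult[symmetric]) measurable
  also have "\<dots> \<le> (\<integral>\<^sup>+x. ennreal (?G x powr p) +
    ennreal ((p - 1) * c powr p) * (ennreal (?d x powr (\<beta> - DIM('a))) * indicator ?S x) \<partial>lborel)"
  proof (rule nn_integral_mono)
    fix x :: 'a
    show "ennreal (p * c powr (p - 1)) *
      (ennreal (?G x * ?d x powr (1 - real DIM('a))) * indicator {x. s \<le> ?d x} x) \<le>
      ennreal (?G x powr p) +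
      ennreal ((p - 1) * c powr p) * (ennreal (?d x powr (\<beta> - DIM('a))) * indicator ?S x)"
    proof (cases "x \<in> ?S")
      case True
      then show ?thesis
        using Young[of x] p_gt_1
        by (simp add: ennreal_mult'[symmetric] ennreal_plus[symmetric] del: ennreal_plus)
    next
      case False
      then show ?thesis
        using test_functions_outside(2)[OF \<phi>, of x] by (cases "x \<in> ball x0 R") auto
    qed
  qed
  also have "\<dots> = (\<integral>\<^sup>+x. ennreal (?G x powr p) \<partial>lborel) + ennreal ((p - 1) * c powr p) *
    (\<integral>\<^sup>+x. ennreal (?d x powr (\<beta> - DIM('a))) * indicator ?S x \<partial>lborel)"
    by (subst nn_integral_add) (auto simp: nn_integral_cmult)
  also have "\<dots> \<le> ennreal I + ennreal ((p - 1) * c powr p) * ennreal (W * D / \<beta>)"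
    using le ennreal_energy_eq[OF \<phi>, of p] p_gt_1
    by (intro add_mono mult_left_mono) (auto simp: I_def W_def D_def)
  also have "\<dots> = ennreal (I + (p - 1) * c powr p * (W * D / \<beta>))"
    using \<open>0 \<le> I\<close> p_gt_1 \<open>0 \<le> W\<close> \<open>0 < D\<close> \<beta>_pos
    by (simp add: ennreal_mult'[symmetric] ennreal_plus[symmetric] del: ennreal_plus)
  finally have "p * c powr (p - 1) * W \<le> I + (p - 1) * c powr p * (W * D / \<beta>)"
    using \<open>0 \<le> I\<close> p_gt_1 \<open>0 \<le> W\<close> \<open>0 < D\<close> \<beta>_pos
    by (subst (asm) ennreal_le_iff) auto
  \<comment> \<open>With this \<open>c\<close> the correction term is exactly \<open>p - 1\<close>
    of the \<open>p\<close> copies of \<open>c powr (p - 1) * W\<close> on the left, so one copy is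
    left as a bound for \<open>I\<close>.\<close>
  moreover have "c powr p * (W * D / \<beta>) = c powr (p - 1) * W"
    using \<open>0 < c\<close> \<open>0 < D\<close> \<beta>_pos by (simp add: powr_diff c_def)
  then have "(p - 1) * c powr p * (W * D / \<beta>) = (p - 1) * (c powr (p - 1) * W)"
    by (simp only: mult.assoc)
  ultimately have "c powr (p - 1) * W \<le> I"
    by (simp add: algebra_simps)
  then show ?thesis
    using \<open>0 < D\<close> \<beta>_pos
    by (simp add: cap_const_def \<beta>_def[symmetric] c_def D_def W_def I_def powr_divide mult_ac)
qed

section \<open>Truncated capacitary potentials\<close>

text \<open>A smooth approximation of the indicator of the interval from \<open>a\<close> to
  \<open>b\<close>. The shift by 1 makes it vanish on margins of width \<open>1 / (m + 1)\<close> at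
  both ends, so its primitives are constant there.\<close>

definition exp_bump :: "real \<Rightarrow> real \<Rightarrow> nat \<Rightarrow> real \<Rightarrow> real" where
  "exp_bump a b m t = exp_cutoff (real (Suc m) * (t - a) - 1) * exp_cutoff (real (Suc m) * (b - t) - 1)"

lemma exp_cutoff_nonneg: "0 \<le> exp_cutoff t"
  and exp_cutoff_le_1: "exp_cutoff t \<le> 1"
  by (auto simp: exp_cutoff_def)

lemma exp_cutoff_tendsto_1: "(exp_cutoff \<longlongrightarrow> 1) at_top"
proof -
  have "((\<lambda>t. exp (- inverse t)) \<longlongrightarrow> exp (- (0::real))) at_top"
    by (intro tendsto_intros tendsto_inverse_0_at_top filterlim_ident)
  then have "((\<lambda>t. exp (- inverse t)) \<longlongrightarrow> (1::real)) at_top"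
    by simp
  then show ?thesis
    by (rule Lim_transform_eventually, intro eventually_mono[OF eventually_gt_at_top[of 0]])
      (simp add: exp_cutoff_def inverse_eq_divide)
qed

lemma exp_bump_nonneg: "0 \<le> exp_bump a b m t"
  and exp_bump_le_1: "exp_bump a b m t \<le> 1"
  by (auto simp: exp_bump_def exp_cutoff_nonneg exp_cutoff_le_1 mult_le_one)

lemma exp_bump_eq_0: "t < a + 1 / real (Suc m) \<or> b - 1 / real (Suc m) < t \<Longrightarrow> exp_bump a b m t = 0"
  by (auto simp: exp_bump_def exp_cutoff_def field_simps)

lemma exp_bump_eq_0_outside:
  assumes "t \<notin> {a<..<b}"
  shows "exp_bump a b m t = 0"
proof (rule exp_bump_eq_0)
  have "0 < 1 / real (Suc m)" by simp
  moreover have "t \<le> a \<or> b \<le> t" using assms by auto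
  ultimately show "t < a + 1 / real (Suc m) \<or> b - 1 / real (Suc m) < t" by linarith
qed

lemma exp_bump_tendsto_1:
  assumes "t \<in> {a<..<b}"
  shows "(\<lambda>m. exp_bump a b m t) \<longlonglongrightarrow> 1"
proof -
  have "(\<lambda>m. exp_cutoff (real (Suc m) * d - 1)) \<longlonglongrightarrow> 1" if "0 < d" for d
  proof (rule filterlim_compose[OF exp_cutoff_tendsto_1])
    have "filterlim (\<lambda>m. - 1 + real (Suc m) * d) at_top sequentially"
      using that
      by (intro filterlim_tendsto_add_at_top[OF tendsto_const] filterlim_at_top_mult_tendsto_pos[OF tendsto_const]
          filterlim_compose[OF filterlim_real_sequentially] filterlim_Suc)
    then show "filterlim (\<lambda>m. real (Suc m) * d - 1) at_top sequentially"
      by simp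
  qed
  from tendsto_mult[OF this[of "t - a"] this[of "b - t"]] show ?thesis
    using assms by (simp add: exp_bump_def)
qed

lemma C_k_exp_bump: "C_k k (exp_bump a b m)"
proof -
  have affine: "C_k j (\<lambda>t. u * t + v)" for j and u v :: real
    by (intro C_k_add C_k_const C_k_linear bounded_linear_mult_right)
  have "C_k k (\<lambda>t. exp_cutoff (real (Suc m) * t + (- real (Suc m) * a - 1)) *
    exp_cutoff (- real (Suc m) * t + (real (Suc m) * b - 1)))"
    by (rule C_k_mult) (rule C_k_compose_real[OF C_k_exp_cutoff affine])+
  moreover have "(\<lambda>t. exp_cutoff (real (Suc m) * t + (- real (Suc m) * a - 1)) *
    exp_cutoff (- real (Suc m) * t + (real (Suc m) * b - 1))) = exp_bump a b m"
    by (simp add: exp_bump_def fun_eq_iff algebra_simps)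
  ultimately show ?thesis by simp
qed

text \<open>For negative \<open>t\<close> the interval \<open>{0..t}\<close> is empty and the
  primitive is 0, in accordance with \<open>g\<close> vanishing below \<open>a\<close>. From
  \<open>a > 0\<close> on, \<open>t\<close> is interior to \<open>{0..t + 1}\<close> and the
  one-sided domain is harmless.\<close>

lemma primitive_has_real_derivative:
  fixes g :: "real \<Rightarrow> real"
  assumes g: "continuous_on UNIV g" and "0 < a" and zero: "\<And>t. t < a \<Longrightarrow> g t = 0"
  shows "((\<lambda>t. integral {0..t} g) has_real_derivative g t) (at t)"
proof (cases "t < a")
  case True
  have "eventually (\<lambda>u. u < a) (nhds t)"
    using True by (simp add: eventually_nhds) (metis lessThan_iff open_lessThan)
  then have "eventually (\<lambda>u. integral {0..u} g = 0) (nhds t)"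
  proof (rule eventually_mono)
    fix u
    assume "u < a"
    then have "integral {0..u} g = integral {0..u} (\<lambda>_. 0)"
      by (intro integral_cong zero) auto
    then show "integral {0..u} g = 0" by simp
  qed
  from DERIV_cong_ev[OF refl this refl, of 0] show ?thesis
    using True zero by simp
next
  case False
  then have "t \<in> {0<..<t + 1}" using \<open>0 < a\<close> by auto
  then have "at t within {0..t + 1} = at t"
    by (intro at_within_interior) (auto simp: interior_atLeastAtMost_real)
  moreover have "((\<lambda>t. integral {0..t} g) has_real_derivative g t) (at t within {0..t + 1})"
    using \<open>t \<in> {0<..<t + 1}\<close> continuous_on_subset[OF g, of "{0..t + 1}"]
    by (intro integral_has_real_derivative) auto
  ultimately show ?thesis by simp
qed

text \<open>Dominated convergence with majorant \<open>t powr (e - 1)\<close>, which is integrable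
  down to \<open>a = 0\<close> because \<open>e > 0\<close>.\<close>

lemma exp_bump_integral_tendsto:
  fixes e a b :: real
  assumes "0 < e" "0 \<le> a" "a \<le> b"
  shows "(\<lambda>m. integral {a<..<b} (\<lambda>t. t powr (e - 1) * exp_bump a b m t)) \<longlonglongrightarrow> (b powr e - a powr e) / e"
    and "(\<lambda>t. t powr (e - 1) * exp_bump a b m t) integrable_on {a<..<b}"
proof -
  have I: "((\<lambda>t. t powr (e - 1)) has_integral (b powr e - a powr e) / e) {a<..<b}"
    using powr_has_integral_Icc[OF assms] by (simp add: has_integral_Icc_iff_Ioo)
  have cont: "continuous_on UNIV (\<lambda>t. t powr (e - 1) * exp_bump a b m t)" for m
  proof -
    have "0 < a + 1 / real (Suc m)" using \<open>0 \<le> a\<close> by (simp add: add_nonneg_pos)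
    from C_k_powr_mult[OF C_k_exp_bump[of 0 a b m] this] show ?thesis
      by (simp add: exp_bump_eq_0)
  qed
  have int: "(\<lambda>t. t powr (e - 1) * exp_bump a b m t) integrable_on {a<..<b}" for m
    using integrable_continuous_interval[OF continuous_on_subset[OF cont, of "{a..b}"]]
    by (simp add: integrable_on_Icc_iff_Ioo)
  then show "(\<lambda>t. t powr (e - 1) * exp_bump a b m t) integrable_on {a<..<b}" .
  have "(\<lambda>m. integral {a<..<b} (\<lambda>t. t powr (e - 1) * exp_bump a b m t)) \<longlonglongrightarrow>
    integral {a<..<b} (\<lambda>t. t powr (e - 1))"
  proof (rule dominated_convergence(2)[OF int has_integral_integrable[OF I]])
    show "norm (t powr (e - 1) * exp_bump a b m t) \<le> t powr (e - 1)" for m t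
      by (simp add: abs_mult exp_bump_nonneg exp_bump_le_1 mult_left_le)
    show "(\<lambda>m. t powr (e - 1) * exp_bump a b m t) \<longlonglongrightarrow> t powr (e - 1)" if "t \<in> {a<..<b}" for t
      using tendsto_mult[OF tendsto_const exp_bump_tendsto_1[OF that]] by simp
  qed
  then show "(\<lambda>m. integral {a<..<b} (\<lambda>t. t powr (e - 1) * exp_bump a b m t)) \<longlonglongrightarrow> (b powr e - a powr e) / e"
    using integral_unique[OF I] by simp
qed

lemma has_derivative_imp_grad:
  assumes "(f has_derivative (\<lambda>h. h \<bullet> v)) (at x)"
  shows "grad f x = v"
proof -
  have "frechet_derivative f (at x) = (\<lambda>h. h \<bullet> v)"
    using frechet_derivative_at[OF assms] by simp
  then show ?thesis
    unfolding grad_def by (simp only:) (subst inner_commute, rule euclidean_representation)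
qed

text \<open>A truncation of the capacitary potential of \<open>cball x0 s\<close> relative to \<open>ball x0 R\<close>, written as
  a function of the smooth quantity \<open>norm (x - x0) ^ 2\<close>.\<close>

lemma exists_truncated_potential:
  fixes x0 :: "'a::euclidean_space" and p s R \<beta> J :: real and m :: nat
  assumes "real DIM('a) < p" and "0 \<le> s" "s < R"
  defines "\<beta> \<equiv> cap_exp p DIM('a)"
  defines "J \<equiv> integral {s\<^sup>2<..<R\<^sup>2} (\<lambda>t. t powr (\<beta> / 2 - 1) * exp_bump (s\<^sup>2) (R\<^sup>2) m t)"
  assumes "0 < J"
  obtains \<phi> where "\<phi> \<in> test_functions (ball x0 R)" "\<And>x. x \<in> cball x0 s \<Longrightarrow> 1 \<le> \<phi> x"
    "(LINT x:ball x0 R|lborel. norm (grad \<phi> x) powr p)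
      \<le> (2 / J) powr p * (DIM('a) * unit_ball_vol DIM('a) * (R powr \<beta> - s powr \<beta>) / \<beta>)"
proof -
  have p_gt_1: "1 < p"
    using \<open>real DIM('a) < p\<close> by (rule DIM_less_imp_gt_1)
  have \<beta>_pos: "0 < \<beta>"
    using \<open>real DIM('a) < p\<close> p_gt_1 by (simp add: \<beta>_def cap_exp_pos)
  define A where "A = DIM('a) * unit_ball_vol DIM('a) * (R powr \<beta> - s powr \<beta>) / \<beta>"
  \<comment> \<open>Here \<open>t\<close> is the squared distance, so
    \<open>t powr (\<beta> / 2)\<close> is the distance to the power \<beta>; \<open>g\<close> is
    its derivative up to a constant, truncated at both ends.\<close>
  define g where "g = (\<lambda>t. t powr (\<beta> / 2 - 1) * exp_bump (s\<^sup>2) (R\<^sup>2) m t)"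
  define \<epsilon> where "\<epsilon> = 1 / real (Suc m)"
  have "0 < \<epsilon>" by (simp add: \<epsilon>_def)
  then have a_pos: "0 < s\<^sup>2 + \<epsilon>" by (simp add: add_nonneg_pos)
  have Ck_g: "C_k k g" for k
    unfolding g_def
    by (rule C_k_powr_mult[OF C_k_exp_bump a_pos]) (simp add: exp_bump_eq_0 \<epsilon>_def)
  have g_0: "g t = 0" if "t < s\<^sup>2 + \<epsilon>" for t
    using that by (simp add: g_def exp_bump_eq_0 \<epsilon>_def)
  define H where "H = (\<lambda>t. integral {0..t} g)"
  have H_deriv: "(H has_real_derivative g t) (at t)" for t
    unfolding H_def by (rule primitive_has_real_derivative[OF C_k_imp_continuous_on[OF Ck_g] a_pos g_0])
  have Ck_H: "C_k k H" for k
    using C_k_Suc_imp[OF C_k_SucI_real[OF H_deriv Ck_g]] .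
  have H_0: "H t = 0" if "t \<le> s\<^sup>2" for t
  proof -
    have "integral {0..t} g = integral {0..t} (\<lambda>_. 0)"
      using that \<open>0 < \<epsilon>\<close> by (intro integral_cong g_0) auto
    then show ?thesis by (simp add: H_def)
  qed
  \<comment> \<open>All the mass of \<open>g\<close> lies below
    \<open>R\<^sup>2 - \<epsilon>\<close>, so \<open>H\<close> reaches its final value before the
    boundary of the ball.\<close>
  have H_J: "H t = J" if "R\<^sup>2 - \<epsilon> < t" for t
  proof -
    have g_int: "(g has_integral J) {s\<^sup>2<..<R\<^sup>2}"
      using exp_bump_integral_tendsto(2)[of "\<beta> / 2" "s\<^sup>2" "R\<^sup>2" m] assms(2,3) \<beta>_pos
      by (auto simp: g_def J_def power_mono integrable_integral)
    have zero: "g u = 0" if "u \<notin> {s\<^sup>2<..<R\<^sup>2} \<inter> {..t}" for u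
    proof -
      have "u \<notin> {s\<^sup>2<..<R\<^sup>2} \<or> R\<^sup>2 - \<epsilon> < u" using that \<open>R\<^sup>2 - \<epsilon> < t\<close> by auto
      then show ?thesis
        using exp_bump_eq_0[of u "s\<^sup>2" m "R\<^sup>2"] exp_bump_eq_0_outside[of u "s\<^sup>2" "R\<^sup>2" m]
        by (auto simp: g_def \<epsilon>_def)
    qed
    have "(g has_integral J) UNIV"
      by (rule has_integral_on_superset[OF g_int]) (use zero in auto)
    then have "((\<lambda>u. if u \<in> {0..t} then g u else 0) has_integral J) UNIV"
    proof (rule has_integral_eq[rotated])
      fix u
      have "u \<in> {0..t}" if "u \<in> {s\<^sup>2<..<R\<^sup>2} \<inter> {..t}"
        using that le_less_trans[OF zero_le_power2, of s u] by simp
      then show "g u = (if u \<in> {0..t} then g u else 0)"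
        using zero by metis
    qed
    then show ?thesis
      by (simp only: has_integral_restrict_UNIV H_def integral_unique)
  qed
  let ?q = "\<lambda>x. norm (x - x0) ^ 2"
  define \<phi> where "\<phi> = (\<lambda>x. 1 + (- 1 / J) * H (?q x))"
  have Ck_\<phi>: "C_k k \<phi>" for k
    unfolding \<phi>_def
    by (intro C_k_add C_k_const C_k_mult C_k_compose_real[OF Ck_H] C_k_norm_square_diff)
  \<comment> \<open>The margin \<epsilon> keeps the closed support strictly inside the open
    ball.\<close>
  have supp: "closure {x. \<phi> x \<noteq> 0} \<subseteq> {x. ?q x \<le> R\<^sup>2 - \<epsilon>}"
  proof (rule closure_minimal)
    show "{x. \<phi> x \<noteq> 0} \<subseteq> {x. ?q x \<le> R\<^sup>2 - \<epsilon>}"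
    proof (rule subsetI, rule ccontr)
      fix x
      assume "x \<in> {x. \<phi> x \<noteq> 0}" "x \<notin> {x. ?q x \<le> R\<^sup>2 - \<epsilon>}"
      then have "H (?q x) = J" "\<phi> x \<noteq> 0" by (simp_all add: H_J)
      then show False using \<open>0 < J\<close> by (simp add: \<phi>_def)
    qed
    show "closed {x. ?q x \<le> R\<^sup>2 - \<epsilon>}"
      by (intro closed_Collect_le continuous_intros)
  qed
  also have "{x. ?q x \<le> R\<^sup>2 - \<epsilon>} \<subseteq> ball x0 R"
  proof
    fix x
    assume "x \<in> {x. ?q x \<le> R\<^sup>2 - \<epsilon>}"
    then have "norm (x - x0) ^ 2 < R ^ 2" using \<open>0 < \<epsilon>\<close> by simp
    then have "norm (x - x0) < R"
      by (rule power2_less_imp_less) (use \<open>0 \<le> s\<close> \<open>s < R\<close> in linarith)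
    then show "x \<in> ball x0 R" by (simp add: dist_norm norm_minus_commute)
  qed
  finally have supp': "closure {x. \<phi> x \<noteq> 0} \<subseteq> ball x0 R" .
  then have "compact (closure {x. \<phi> x \<noteq> 0})"
    using bounded_subset[OF bounded_ball] by (auto simp: compact_eq_bounded_closed)
  then have \<phi>: "\<phi> \<in> test_functions (ball x0 R)"
    using Ck_\<phi> supp' by (simp add: test_functions_def)
  have one: "1 \<le> \<phi> x" if "x \<in> cball x0 s" for x
  proof -
    have "?q x \<le> s\<^sup>2"
      using that by (intro power_mono) (auto simp: dist_norm norm_minus_commute)
    then show ?thesis by (simp add: \<phi>_def H_0)
  qed
  have grad: "grad \<phi> x = (- 2 / J * g (?q x)) *\<^sub>R (x - x0)" for x
  proof (rule has_derivative_imp_grad)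
    have q: "(?q has_derivative (\<lambda>h. 2 * (h \<bullet> (x - x0)))) (at x)"
      unfolding power2_norm_eq_inner
      by (auto intro!: derivative_eq_intros simp: inner_commute algebra_simps)
    have "((\<lambda>x. H (?q x)) has_derivative (\<lambda>h. g (?q x) * (2 * (h \<bullet> (x - x0))))) (at x)"
      using has_derivative_compose[OF q has_field_derivative_imp_has_derivative[OF H_deriv]] .
    from has_derivative_add[OF has_derivative_const has_derivative_mult_right[OF this]]
    show "(\<phi> has_derivative (\<lambda>h. h \<bullet> ((- 2 / J * g (?q x)) *\<^sub>R (x - x0)))) (at x)"
      unfolding \<phi>_def by (rule has_derivative_eq_rhs) (simp add: fun_eq_iff mult_ac)
  qed
  \<comment> \<open>Bounding the bump by 1 leaves the energy density of the untruncated potential,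
    with \<open>2 / J\<close> as normalising factor; the 2 comes from differentiating the squared
    distance.\<close>
  have "ennreal (norm (grad \<phi> x) powr p) \<le> ennreal ((2 / J) powr p) *
    (ennreal (norm (x - x0) powr (\<beta> - DIM('a))) * indicator {s..R} (norm (x - x0)))" for x
  proof (cases "?q x \<in> {s\<^sup>2<..<R\<^sup>2}")
    case False
    then have "grad \<phi> x = 0"
      by (simp add: grad g_def exp_bump_eq_0_outside)
    then show ?thesis by simp
  next
    case True
    define r where "r = norm (x - x0)"
    have "s < r" "r < R"
      using True \<open>0 \<le> s\<close> \<open>s < R\<close> power2_less_imp_less[of s r] power2_less_imp_less[of r R]
      by (auto simp: r_def)
    then have "0 < r" using \<open>0 \<le> s\<close> by simp
    have "(r\<^sup>2) powr (\<beta> / 2 - 1) = (r powr 2) powr (\<beta> / 2 - 1)"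
      using \<open>0 < r\<close> by simp
    also have "\<dots> = r powr (2 * (\<beta> / 2 - 1))"
      by (rule powr_powr)
    finally have "r * (r\<^sup>2) powr (\<beta> / 2 - 1) = r powr 1 * r powr (2 * (\<beta> / 2 - 1))"
      using \<open>0 < r\<close> by simp
    also have "\<dots> = r powr (\<beta> - 1)"
      by (subst powr_add[symmetric]) (rule arg_cong[of _ _ "(powr) r"], simp)
    finally have "r * (r\<^sup>2) powr (\<beta> / 2 - 1) = r powr (\<beta> - 1)" .
    moreover have "norm (grad \<phi> x) = 2 / J * (r * ((r\<^sup>2) powr (\<beta> / 2 - 1)) * exp_bump (s\<^sup>2) (R\<^sup>2) m (r\<^sup>2))"
      using \<open>0 < J\<close> by (simp add: grad g_def r_def abs_mult exp_bump_nonneg)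
    ultimately have "norm (grad \<phi> x) \<le> 2 / J * r powr (\<beta> - 1)"
      using \<open>0 < J\<close> by (simp add: exp_bump_le_1 exp_bump_nonneg mult_left_le divide_right_mono)
    then have "norm (grad \<phi> x) powr p \<le> (2 / J * r powr (\<beta> - 1)) powr p"
      using p_gt_1 by (intro powr_mono2) auto
    also have "\<dots> = (2 / J) powr p * r powr (\<beta> - DIM('a))"
      using \<open>0 < J\<close> cap_exp_eqs(2)[OF p_gt_1] by (simp only: powr_mult powr_powr \<beta>_def)
    finally show ?thesis
      using \<open>s < r\<close> \<open>r < R\<close> by (simp add: r_def ennreal_mult'[symmetric])
  qed
  then have "(\<integral>\<^sup>+x. ennreal (norm (grad \<phi> x) powr p) \<partial>lborel) \<le> (\<integral>\<^sup>+x. ennreal ((2 / J) powr p) *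
    (ennreal (norm (x - x0) powr (\<beta> - DIM('a))) * indicator {s..R} (norm (x - x0))) \<partial>lborel)"
    by (rule nn_integral_mono)
  also have "\<dots> = ennreal ((2 / J) powr p) * ennreal A"
    unfolding A_def using assms(2,3) \<beta>_pos
    by (subst nn_integral_cmult) (auto simp: nn_integral_norm_powr_annulus)
  also have "\<dots> = ennreal ((2 / J) powr p * A)"
    by (rule ennreal_mult'[symmetric]) simp
  finally have "ennreal (LINT x:ball x0 R|lborel. norm (grad \<phi> x) powr p) \<le> ennreal ((2 / J) powr p * A)"
    using ennreal_energy_eq[OF \<phi>, of p] p_gt_1 by simp
  moreover have "0 \<le> (2 / J) powr p * A"
    using assms(2,3) \<beta>_pos powr_mono2[of \<beta> s R] by (simp add: A_def)
  ultimately have "(LINT x:ball x0 R|lborel. norm (grad \<phi> x) powr p) \<le> (2 / J) powr p * A"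
    by (simp only: ennreal_le_iff)
  with \<phi> one show ?thesis
    unfolding A_def by (rule that)
qed

section \<open>Capacities and inradii\<close>

lemma p_cap_le:
  assumes "\<phi> \<in> test_functions E" "\<And>x. x \<in> K \<Longrightarrow> 1 \<le> \<phi> x"
  shows "p_cap p K E \<le> (LINT x:E|lborel. norm (grad \<phi> x) powr p)"
  unfolding p_cap_def
  by (rule cINF_lower) (use assms in \<open>auto simp: set_lebesgue_integral_def intro!: bdd_belowI2[of _ 0]\<close>)

lemma p_cap_empty_le: "p_cap p {} E \<le> 0"
proof -
  have "(\<lambda>_. 0) \<in> test_functions E"
    by (simp add: test_functions_def)
  moreover have "grad (\<lambda>_. 0 :: real) x = 0" for x :: 'a
    by (rule has_derivative_imp_grad) simp
  ultimately show ?thesis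
    using p_cap_le[of "\<lambda>_. 0" E "{}" p] by (simp add: set_lebesgue_integral_def)
qed

text \<open>As \<open>m\<close> grows, \<open>J m\<close> tends to \<open>2 * D / \<beta>\<close>,
  and the energy bounds of the truncated potentials tend to \<open>(\<beta> / D) powr p * A\<close>,
  which is the claimed value. Positivity of a single \<open>J m\<close> already yields an admissible
  function.\<close>

lemma
  fixes x0 :: "'a::euclidean_space" and p s R \<beta> :: real
  assumes "real DIM('a) < p" and "0 \<le> s" "s < R"
  defines "\<beta> \<equiv> cap_exp p DIM('a)"
  shows exists_admissible: "\<exists>\<phi> \<in> test_functions (ball x0 R). \<forall>x \<in> cball x0 s. 1 \<le> \<phi> x"
    and p_cap_cball_le: "p_cap p (cball x0 s) (ball x0 R) \<le> cap_const p DIM('a) / (R powr \<beta> - s powr \<beta>) powr (p - 1)"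
proof -
  have "1 < p"
    using \<open>real DIM('a) < p\<close> by (rule DIM_less_imp_gt_1)
  have "0 < \<beta>"
    using \<open>real DIM('a) < p\<close> \<open>1 < p\<close> by (simp add: \<beta>_def cap_exp_pos)
  define D where "D = R powr \<beta> - s powr \<beta>"
  have "0 < D"
    using \<open>0 \<le> s\<close> \<open>s < R\<close> \<open>0 < \<beta>\<close> by (simp add: D_def powr_less_mono2)
  define A where "A = DIM('a) * unit_ball_vol DIM('a) * D / \<beta>"
  define J where "J = (\<lambda>m. integral {s\<^sup>2<..<R\<^sup>2} (\<lambda>t. t powr (\<beta> / 2 - 1) * exp_bump (s\<^sup>2) (R\<^sup>2) m t))"
  have square_powr: "(r\<^sup>2) powr (\<beta> / 2) = r powr \<beta>" if "0 \<le> r" for r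
    using that powr_powr[of r 2 "\<beta> / 2"] by simp
  have J_lim: "J \<longlonglongrightarrow> 2 * D / \<beta>"
    using exp_bump_integral_tendsto(1)[of "\<beta> / 2" "s\<^sup>2" "R\<^sup>2"] \<open>0 \<le> s\<close> \<open>s < R\<close> \<open>0 < \<beta>\<close>
    by (simp add: J_def D_def square_powr power_mono mult.commute)
  have "eventually (\<lambda>m. 0 < J m) sequentially"
    using \<open>0 < D\<close> \<open>0 < \<beta>\<close> by (intro order_tendstoD(1)[OF J_lim]) auto
  then obtain M where M: "\<And>m. M \<le> m \<Longrightarrow> 0 < J m"
    by (auto simp: eventually_sequentially)
  have ex: "\<exists>\<phi> \<in> test_functions (ball x0 R). (\<forall>x \<in> cball x0 s. 1 \<le> \<phi> x) \<and>
    (LINT x:ball x0 R|lborel. norm (grad \<phi> x) powr p) \<le> (2 / J m) powr p * A" if "M \<le> m" for m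
    unfolding J_def A_def D_def \<beta>_def
    by (rule exists_truncated_potential[OF assms(1-3) M[OF that, unfolded J_def \<beta>_def], of x0]) blast
  then show "\<exists>\<phi> \<in> test_functions (ball x0 R). \<forall>x \<in> cball x0 s. 1 \<le> \<phi> x"
    by blast
  have "p_cap p (cball x0 s) (ball x0 R) \<le> (2 / J m) powr p * A" if m: "M \<le> m" for m
  proof -
    obtain \<phi> where \<phi>: "\<phi> \<in> test_functions (ball x0 R)" "\<forall>x \<in> cball x0 s. 1 \<le> \<phi> x"
      "(LINT x:ball x0 R|lborel. norm (grad \<phi> x) powr p) \<le> (2 / J m) powr p * A"
      using ex[OF m] by blast
    have "p_cap p (cball x0 s) (ball x0 R) \<le> (LINT x:ball x0 R|lborel. norm (grad \<phi> x) powr p)"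
      by (rule p_cap_le[OF \<phi>(1)]) (use \<phi>(2) in blast)
    then show ?thesis
      using \<phi>(3) by (rule order_trans)
  qed
  moreover have "(\<lambda>m. (2 / J m) powr p * A) \<longlonglongrightarrow> (2 / (2 * D / \<beta>)) powr p * A"
    using \<open>0 < D\<close> \<open>0 < \<beta>\<close> \<open>1 < p\<close>
    by (intro tendsto_intros J_lim) auto
  ultimately have "p_cap p (cball x0 s) (ball x0 R) \<le> (2 / (2 * D / \<beta>)) powr p * A"
    by (intro LIMSEQ_le_const) auto
  also have "\<dots> = (\<beta> powr p / \<beta>) * (DIM('a) * unit_ball_vol DIM('a)) / (D powr p / D)"
    using \<open>0 < D\<close> \<open>0 < \<beta>\<close> by (simp add: A_def powr_divide mult_ac)
  also have "\<dots> = cap_const p DIM('a) / D powr (p - 1)"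
    using \<open>0 < D\<close> \<open>0 < \<beta>\<close> by (simp add: cap_const_def \<beta>_def[symmetric] powr_diff)
  finally show "p_cap p (cball x0 s) (ball x0 R) \<le> cap_const p DIM('a) / (R powr \<beta> - s powr \<beta>) powr (p - 1)"
    by (simp add: D_def)
qed

text \<open>Lower bounds pass to an infimum in the reals only over a nonempty set; a function
  admissible for the larger \<open>cball x0 s\<close> provides nonemptiness.\<close>

lemma p_cap_greatest:
  fixes x0 :: "'a::euclidean_space"
  assumes "real DIM('a) < p" "0 \<le> s" "s < R" "K \<subseteq> cball x0 s"
    and "\<And>\<phi>. \<phi> \<in> test_functions (ball x0 R) \<Longrightarrow> (\<And>x. x \<in> K \<Longrightarrow> 1 \<le> \<phi> x) \<Longrightarrow>
      c \<le> (LINT x:ball x0 R|lborel. norm (grad \<phi> x) powr p)"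
  shows "c \<le> p_cap p K (ball x0 R)"
  unfolding p_cap_def
proof (rule cINF_greatest)
  show "{\<phi> \<in> test_functions (ball x0 R). \<forall>x\<in>K. 1 \<le> \<phi> x} \<noteq> {}"
    using exists_admissible[OF assms(1-3), of x0] \<open>K \<subseteq> cball x0 s\<close> by blast
  show "c \<le> (LINT x:ball x0 R|lborel. norm (grad \<phi> x) powr p)"
    if "\<phi> \<in> {\<phi> \<in> test_functions (ball x0 R). \<forall>x\<in>K. 1 \<le> \<phi> x}" for \<phi>
    by (rule assms(5)) (use that in simp_all)
qed

text \<open>The truncated potentials give the upper bound. For the lower bound the energy estimate
  is centred at \<open>x0\<close>, where its integral hypothesis is the annulus formula. The case
  \<open>s = 0\<close> is the capacity of a point.\<close>

lemma p_cap_cball: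
  fixes x0 :: "'a::euclidean_space" and p s R \<beta> :: real
  assumes "real DIM('a) < p" and "0 \<le> s" "s < R"
  defines "\<beta> \<equiv> cap_exp p DIM('a)"
  shows "p_cap p (cball x0 s) (ball x0 R) = cap_const p DIM('a) / (R powr \<beta> - s powr \<beta>) powr (p - 1)"
proof (rule antisym)
  show "p_cap p (cball x0 s) (ball x0 R) \<le> cap_const p DIM('a) / (R powr \<beta> - s powr \<beta>) powr (p - 1)"
    unfolding \<beta>_def by (rule p_cap_cball_le[OF assms(1-3)])
  show "cap_const p DIM('a) / (R powr \<beta> - s powr \<beta>) powr (p - 1) \<le> p_cap p (cball x0 s) (ball x0 R)"
  proof (rule p_cap_greatest[OF assms(1-3) order_refl])
    fix \<phi>
    assume \<phi>: "\<phi> \<in> test_functions (ball x0 R)" and one: "\<And>x. x \<in> cball x0 s \<Longrightarrow> 1 \<le> \<phi> x"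
    show "cap_const p DIM('a) / (R powr \<beta> - s powr \<beta>) powr (p - 1)
      \<le> (LINT x:ball x0 R|lborel. norm (grad \<phi> x) powr p)"
      unfolding \<beta>_def
    proof (rule energy_ge[OF assms(1) \<phi> assms(2,3)])
      show "1 \<le> \<phi> z" if "dist z x0 = s" for z
        using that by (intro one) (simp add: dist_commute)
      have "0 < \<beta>"
        using \<open>real DIM('a) < p\<close> DIM_less_imp_gt_1[OF assms(1)] by (simp add: \<beta>_def cap_exp_pos)
      have "(\<integral>\<^sup>+x. ennreal (norm (x - x0) powr (\<beta> - DIM('a))) *
          indicator (ball x0 R \<inter> {x. s \<le> norm (x - x0)}) x \<partial>lborel)
        \<le> (\<integral>\<^sup>+x. ennreal (norm (x - x0) powr (\<beta> - DIM('a))) * indicator {s..R} (norm (x - x0)) \<partial>lborel)"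
        by (intro nn_integral_mono) (auto simp: dist_norm norm_minus_commute split: split_indicator)
      also have "\<dots> = ennreal (DIM('a) * unit_ball_vol DIM('a) * (R powr \<beta> - s powr \<beta>) / \<beta>)"
        using \<open>0 < \<beta>\<close> assms(2,3) by (intro nn_integral_norm_powr_annulus) auto
      finally show "(\<integral>\<^sup>+x. ennreal (norm (x - x0) powr (cap_exp p DIM('a) - DIM('a))) *
          indicator (ball x0 R \<inter> {x. s \<le> norm (x - x0)}) x \<partial>lborel)
        \<le> ennreal (DIM('a) * unit_ball_vol DIM('a) *
          (R powr cap_exp p DIM('a) - s powr cap_exp p DIM('a)) / cap_exp p DIM('a))"
        by (simp only: \<beta>_def)
    qed
  qed
qed

text \<open>A point is cheapest at the centre: the energy estimate from \<open>y\<close> involves the integral of a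
  decreasing function of the distance to \<open>y\<close>, which over balls of radius \<open>R\<close> is maximal for \<open>ball y R\<close>.\<close>

lemma p_cap_ge_point:
  fixes x0 y :: "'a::euclidean_space" and p s R \<beta> :: real
  assumes "real DIM('a) < p" and "0 \<le> s" "s < R" and "K \<subseteq> cball x0 s" "y \<in> K"
  defines "\<beta> \<equiv> cap_exp p DIM('a)"
  shows "cap_const p DIM('a) / (R powr \<beta>) powr (p - 1) \<le> p_cap p K (ball x0 R)"
proof (rule p_cap_greatest[OF assms(1-4)])
  fix \<phi>
  assume \<phi>: "\<phi> \<in> test_functions (ball x0 R)" and one: "\<And>x. x \<in> K \<Longrightarrow> 1 \<le> \<phi> x"
  have "1 < p"
    using \<open>real DIM('a) < p\<close> by (rule DIM_less_imp_gt_1)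
  then have "0 < \<beta>"
    using \<open>real DIM('a) < p\<close> by (simp add: \<beta>_def cap_exp_pos)
  \<comment> \<open>Makes the exponent \<open>\<beta> - DIM('a)\<close> nonpositive, so that the
    integrand does not increase with the distance to \<open>y\<close>.\<close>
  have "\<beta> \<le> DIM('a)"
  proof -
    have "1 \<le> real DIM('a)" by (simp add: Suc_leI)
    then have "(\<beta> - 1) * (p - 1) \<le> 0"
      using cap_exp_eqs(1)[OF \<open>1 < p\<close>, of "DIM('a)"] by (simp add: \<beta>_def)
    then have "\<beta> \<le> 1"
      using \<open>1 < p\<close> by (simp add: mult_le_0_iff)
    then show ?thesis
      using \<open>1 \<le> real DIM('a)\<close> by linarith
  qed
  \<comment> \<open>Since \<open>0 powr _\<close> is 0, monotonicity fails at \<open>x = y\<close>;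
    that point lies in both balls and hence in neither difference.\<close>
  have "y \<in> ball x0 R"
    using \<open>K \<subseteq> cball x0 s\<close> \<open>y \<in> K\<close> \<open>s < R\<close> by auto
  have "0 < R" using \<open>0 \<le> s\<close> \<open>s < R\<close> by simp
  let ?f = "\<lambda>x. ennreal (norm (x - y) powr (\<beta> - DIM('a)))"
  have "(\<integral>\<^sup>+x. ?f x * indicator (ball x0 R) x \<partial>lborel) \<le> (\<integral>\<^sup>+x. ?f x * indicator (ball y R) x \<partial>lborel)"
  proof (rule nn_integral_le_bathtub[where c = "ennreal (R powr (\<beta> - DIM('a)))"])
    show "?f x \<le> ennreal (R powr (\<beta> - DIM('a)))" if "x \<in> ball x0 R - ball y R" for x
      using that \<open>\<beta> \<le> DIM('a)\<close> \<open>0 < R\<close>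
      by (intro ennreal_leI powr_mono2') (auto simp: dist_norm norm_minus_commute)
    show "ennreal (R powr (\<beta> - DIM('a))) \<le> ?f x" if "x \<in> ball y R - ball x0 R" for x
      using that \<open>\<beta> \<le> DIM('a)\<close> \<open>0 < R\<close> \<open>y \<in> ball x0 R\<close>
      by (intro ennreal_leI powr_mono2') (auto simp: dist_norm norm_minus_commute)
  qed (use \<open>0 < R\<close> in \<open>auto simp: emeasure_ball\<close>)
  also have "\<dots> \<le> (\<integral>\<^sup>+x. ?f x * indicator {0..R} (norm (x - y)) \<partial>lborel)"
    by (intro nn_integral_mono) (auto simp: dist_norm norm_minus_commute split: split_indicator)
  also have "\<dots> = ennreal (DIM('a) * unit_ball_vol DIM('a) * (R powr \<beta> - 0 powr \<beta>) / \<beta>)"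
    using \<open>0 < \<beta>\<close> \<open>0 < R\<close> by (intro nn_integral_norm_powr_annulus) auto
  finally have le: "(\<integral>\<^sup>+x. ?f x * indicator (ball x0 R \<inter> {x. 0 \<le> norm (x - y)}) x \<partial>lborel)
    \<le> ennreal (DIM('a) * unit_ball_vol DIM('a) * (R powr \<beta> - 0 powr \<beta>) / \<beta>)"
    by simp
  have "1 \<le> \<phi> z" if "dist z y = 0" for z
    using that one \<open>y \<in> K\<close> by simp
  from energy_ge[OF assms(1) \<phi> order_refl \<open>0 < R\<close> this le[unfolded \<beta>_def]]
  show "cap_const p DIM('a) / (R powr \<beta>) powr (p - 1)
    \<le> (LINT x:ball x0 R|lborel. norm (grad \<phi> x) powr p)"
    by (simp add: \<beta>_def)
qed

text \<open>Both denominators are homogeneous in \<open>r\<close> of degree \<open>p - n\<close>,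
  because \<open>\<beta> * (p - 1) = p - n\<close>. The powers of \<open>r\<close> cancel, and the
  ratio is the same at every scale.\<close>

lemma cap_ratio:
  fixes n p r :: real
  assumes "n < p" "1 < p" "0 < r"
  defines "\<beta> \<equiv> cap_exp p n"
  shows "1 / 2 powr (p - n) * (2 powr \<beta> - 1) powr (p - 1) *
      (c / ((2 * r) powr \<beta> - r powr \<beta>) powr (p - 1)) = c / ((2 * r) powr \<beta>) powr (p - 1)"
proof -
  have "0 < \<beta>" using assms by (simp add: \<beta>_def cap_exp_pos)
  then have "1 < 2 powr \<beta>" by simp
  have \<beta>: "\<beta> * (p - 1) = p - n" using \<open>1 < p\<close> by (simp add: \<beta>_def cap_exp_def)
  have "(2 * r) powr \<beta> - r powr \<beta> = (2 powr \<beta> - 1) * r powr \<beta>"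
    using \<open>0 < r\<close> by (simp add: powr_mult left_diff_distrib)
  then have *: "((2 * r) powr \<beta> - r powr \<beta>) powr (p - 1) = (2 powr \<beta> - 1) powr (p - 1) * r powr (p - n)"
    using \<open>1 < 2 powr \<beta>\<close> by (simp add: powr_mult powr_powr \<beta>)
  have "((2 * r) powr \<beta>) powr (p - 1) = 2 powr (p - n) * r powr (p - n)"
    using \<open>0 < r\<close> by (simp add: powr_powr \<beta> powr_mult)
  then show ?thesis
    using \<open>0 < \<beta>\<close> \<open>0 < r\<close> by (simp add: *)
qed

text \<open>An open ball inside \<Omega> contains the concentric closed balls of smaller radius
  \<open>t\<close>; these leave an empty, hence negligible, difference. Letting \<open>t\<close>
  tend to \<open>r\<close> from below recovers \<open>r\<close>.\<close>

lemma inradius_le_cap_inradius: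
  fixes \<Omega> :: "'a::euclidean_space set"
  assumes "real DIM('a) < p" "0 \<le> \<gamma>"
  shows "inradius \<Omega> \<le> cap_inradius p \<gamma> \<Omega>"
  unfolding inradius_def
proof (rule SUP_least)
  fix r :: real
  assume "r \<in> {r. 0 < r \<and> (\<exists>x0. ball x0 r \<subseteq> \<Omega>)}"
  then obtain x0 where "0 < r" and ball: "ball x0 r \<subseteq> \<Omega>" by blast
  have le: "ennreal t \<le> cap_inradius p \<gamma> \<Omega>" if "0 < t" "t < r" for t
    unfolding cap_inradius_def
  proof (rule SUP_upper, intro CollectI conjI exI)
    have empty: "cball x0 t - \<Omega> = {}"
      using ball \<open>t < r\<close> by auto
    have "0 \<le> p_cap p (cball x0 t) (ball x0 (2 * t))"
      using that cap_const_pos[of "DIM('a)" p] assms(1) DIM_less_imp_gt_1[OF assms(1)]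
      by (subst p_cap_cball) auto
    then show "pg_negligible p \<gamma> x0 t (cball x0 t - \<Omega>)"
      using p_cap_empty_le[of p "ball x0 (2 * t)"] \<open>0 \<le> \<gamma>\<close>
      by (auto simp: pg_negligible_def empty intro: order_trans)
  qed (fact \<open>0 < t\<close>)
  have "(ennreal \<longlongrightarrow> ennreal r) (at_left r)"
    by (rule tendsto_ennrealI) (rule tendsto_ident_at)
  moreover have "eventually (\<lambda>t. ennreal t \<le> cap_inradius p \<gamma> \<Omega>) (at_left r)"
    using eventually_at_left_real[OF \<open>0 < r\<close>] by (rule eventually_mono) (simp add: le)
  ultimately show "ennreal r \<le> cap_inradius p \<gamma> \<Omega>"
    by (rule tendsto_upperbound) simp
qed

text \<open>Avoiding the origin forces \<open>r \<le> dist x0 0\<close>, and staying in the ball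
  forces \<open>dist x0 0 + r \<le> R\<close>; adding the two gives
  \<open>2 * r \<le> R\<close>.\<close>

lemma inradius_punctured_ball_le: "inradius (ball (0::'a::euclidean_space) R - {0}) \<le> ennreal (R / 2)"
  unfolding inradius_def
proof (rule SUP_least)
  fix r :: real
  assume "r \<in> {r. 0 < r \<and> (\<exists>x0. ball x0 r \<subseteq> ball (0::'a) R - {0})}"
  then obtain x0 :: 'a where "0 < r" and sub: "ball x0 r \<subseteq> ball 0 R - {0}" by blast
  then have "ball x0 r \<subseteq> ball 0 R" "0 \<notin> ball x0 r" by blast+
  then have "dist x0 0 + r \<le> R" "r \<le> dist x0 0"
    using \<open>0 < r\<close> by (auto simp: ball_subset_ball_iff)
  then show "ennreal r \<le> ennreal (R / 2)"
    by (intro ennreal_leI) simp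
qed

theorem proposition7p3:
  fixes p \<gamma>0 :: real
  assumes "2 \<le> CARD('n::finite)"
    and "real CARD('n) < p"
    and "\<gamma>0 = p_cap p {0 :: real ^ 'n} (ball 0 2) / p_cap p (cball (0 :: real ^ 'n) 1) (ball 0 2)"
  shows "\<gamma>0 = 1 / 2 powr (p - real CARD('n)) *
              (2 powr ((p - real CARD('n)) / (p - 1)) - 1) powr (p - 1)
    \<and> (\<forall>\<Omega> :: (real ^ 'n) set. open \<Omega> \<longrightarrow>
          (\<forall>\<gamma>. 0 \<le> \<gamma> \<and> \<gamma> < \<gamma>0 \<longrightarrow> cap_inradius p \<gamma> \<Omega> = inradius \<Omega>))
    \<and> (\<forall>R>0. \<forall>\<gamma>. \<gamma>0 \<le> \<gamma> \<and> \<gamma> < 1 \<longrightarrow>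
          cap_inradius p \<gamma> (ball (0 :: real ^ 'n) R - {0}) > inradius (ball (0 :: real ^ 'n) R - {0}))"
proof -
  let ?n = "real CARD('n)"
  define \<beta> where "\<beta> = cap_exp p ?n"
  define c where "c = cap_const p ?n"
  have DIM: "real DIM(real ^ 'n) < p"
    using assms(2) by simp
  have "1 < p"
    using DIM by (rule DIM_less_imp_gt_1)
  have "0 < \<beta>"
    using assms(2) \<open>1 < p\<close> by (simp add: \<beta>_def cap_exp_pos)
  have "0 < c"
    using assms(1,2) \<open>1 < p\<close> by (simp add: c_def cap_const_pos)
  have cap_ball: "p_cap p (cball x0 s) (ball x0 R) = c / (R powr \<beta> - s powr \<beta>) powr (p - 1)"
    if "0 \<le> s" "s < R" for s R and x0 :: "real ^ 'n"
    using p_cap_cball[OF DIM that, of x0] by (simp add: \<beta>_def c_def)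
  define \<delta> where "\<delta> = 1 / 2 powr (p - ?n) * (2 powr \<beta> - 1) powr (p - 1)"
  have ratio: "\<delta> * p_cap p (cball x0 r) (ball x0 (2 * r)) = c / ((2 * r) powr \<beta>) powr (p - 1)"
    if "0 < r" for r and x0 :: "real ^ 'n"
    using that cap_ratio[OF assms(2) \<open>1 < p\<close> that, of c] by (simp add: cap_ball \<delta>_def \<beta>_def)
  have cap_pos: "0 < p_cap p (cball x0 r) (ball x0 (2 * r))" if "0 < r" for r and x0 :: "real ^ 'n"
    using that \<open>0 < c\<close> \<open>0 < \<beta>\<close> powr_less_mono2[of \<beta> r "2 * r"] by (simp add: cap_ball)
  \<comment> \<open>A point is a closed ball of radius 0, and \<open>0 powr \<beta>\<close> is
    0.\<close>
  have point: "p_cap p {x0} (ball x0 (2 * r)) = \<delta> * p_cap p (cball x0 r) (ball x0 (2 * r))"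
    if "0 < r" for r and x0 :: "real ^ 'n"
    using that cap_ball[of 0 "2 * r" x0] by (simp add: ratio)
  have \<gamma>0: "\<gamma>0 = \<delta>"
    using point[of 1 0] cap_pos[of 1 0] assms(3) by simp
  have "cap_inradius p \<gamma> \<Omega> = inradius \<Omega>" if "0 \<le> \<gamma>" "\<gamma> < \<gamma>0" for \<gamma> and \<Omega> :: "(real ^ 'n) set"
  proof (rule antisym)
    show "cap_inradius p \<gamma> \<Omega> \<le> inradius \<Omega>"
      unfolding cap_inradius_def inradius_def
    proof (rule SUP_subset_mono)
      show "{r. 0 < r \<and> (\<exists>x0. pg_negligible p \<gamma> x0 r (cball x0 r - \<Omega>))}
        \<subseteq> {r. 0 < r \<and> (\<exists>x0. ball x0 r \<subseteq> \<Omega>)}"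
      proof
        fix r
        assume "r \<in> {r. 0 < r \<and> (\<exists>x0. pg_negligible p \<gamma> x0 r (cball x0 r - \<Omega>))}"
        then obtain x0 where "0 < r" and neg: "pg_negligible p \<gamma> x0 r (cball x0 r - \<Omega>)"
          by blast
        \<comment> \<open>A single point of the ball outside \<Omega> costs at least
          \<open>\<gamma>0\<close> times the positive capacity of the ball, more than negligibility
          with \<open>\<gamma> < \<gamma>0\<close> allows.\<close>
        have "cball x0 r \<subseteq> \<Omega>"
        proof (rule ccontr)
          assume "\<not> cball x0 r \<subseteq> \<Omega>"
          then obtain y where "y \<in> cball x0 r - \<Omega>" by blast
          then have "\<gamma>0 * p_cap p (cball x0 r) (ball x0 (2 * r)) \<le> p_cap p (cball x0 r - \<Omega>) (ball x0 (2 * r))"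
            using p_cap_ge_point[OF DIM, of r "2 * r" "cball x0 r - \<Omega>" x0 y] \<open>0 < r\<close>
            by (simp add: \<gamma>0 ratio c_def \<beta>_def)
          also have "\<dots> \<le> \<gamma> * p_cap p (cball x0 r) (ball x0 (2 * r))"
            using neg by (simp add: pg_negligible_def)
          finally show False
            using \<open>\<gamma> < \<gamma>0\<close> cap_pos[OF \<open>0 < r\<close>, of x0] by simp
        qed
        then show "r \<in> {r. 0 < r \<and> (\<exists>x0. ball x0 r \<subseteq> \<Omega>)}"
          using \<open>0 < r\<close> ball_subset_cball by blast
      qed
    qed simp
    show "inradius \<Omega> \<le> cap_inradius p \<gamma> \<Omega>"
      using DIM \<open>0 \<le> \<gamma>\<close> by (rule inradius_le_cap_inradius)
  qed
  moreover have "inradius (ball (0 :: real ^ 'n) R - {0}) < cap_inradius p \<gamma> (ball (0 :: real ^ 'n) R - {0})"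
    if "0 < R" "\<gamma>0 \<le> \<gamma>" for R \<gamma>
  proof -
    \<comment> \<open>Any radius strictly between \<open>R / 2\<close> and \<open>R\<close> serves:
      below \<open>R\<close> only the centre is removed, and above \<open>R / 2\<close> the inradius
      is exceeded.\<close>
    define r where "r = 3 / 4 * R"
    have "0 < r" "r < R" using \<open>0 < R\<close> by (auto simp: r_def)
    then have diff: "cball (0 :: real ^ 'n) r - (ball 0 R - {0}) = {0}" by auto
    have "pg_negligible p \<gamma> 0 r (cball (0 :: real ^ 'n) r - (ball 0 R - {0}))"
      using \<open>0 < r\<close> \<open>\<gamma>0 \<le> \<gamma>\<close> cap_pos[OF \<open>0 < r\<close>, of 0]
      unfolding pg_negligible_def diff point[OF \<open>0 < r\<close>] by (simp add: \<gamma>0 mult_right_mono)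
    then have "ennreal r \<le> cap_inradius p \<gamma> (ball (0 :: real ^ 'n) R - {0})"
      unfolding cap_inradius_def using \<open>0 < r\<close> by (intro SUP_upper) blast
    moreover have "ennreal (R / 2) < ennreal r"
      using \<open>0 < R\<close> by (intro ennreal_lessI) (auto simp: r_def)
    ultimately show ?thesis
      using inradius_punctured_ball_le[of R] by (meson le_less_trans less_le_trans)
  qed
  ultimately show ?thesis
    unfolding \<gamma>0 by (simp add: \<delta>_def \<beta>_def cap_exp_def)
qed

end
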